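(* Let $d,n_S,n_U\ge1$, $\sigma>0$, $r>0$, $\rho>0$, $\delta\in(0,1)$. Let $p_S,p_T$ be mean-zero $\rho^2$-subgaussian distributions on $\mathbb{R}^d$ with second-moment matrices $\Sigma_S=\mathbb{E}_{p_S}[\mathbf{x}\mathbf{x}^\top]$ (invertible) and $\Sigma_T=\mathbb{E}_{p_T}[\mathbf{x}\mathbf{x}^\top]$. Let $X_S\in\mathbb{R}^{n_S\times d}$ have i.i.d. rows from $p_S$ and $X_U\in\mathbb{R}^{n_U\times d}$ i.i.d. rows from $p_T$, independent; put $\hat\Sigma_S=X_S^\top X_S/n_S$, $\hat\Sigma_U=X_U^\top X_U/n_U$. Observations are $\mathbf{y}_S=X_S\boldsymbol{\beta}^*+\mathbf{z}$, $\mathbf{z}\sim\mathcal{N}(0,\sigma^2I_{n_S})$, $\boldsymbol{\beta}^*\in\mathcal{B}:=\{\boldsymbol{\beta}:\|\boldsymbol{\beta}\|_2\le r\}$. Let $\hat C$ be the $C$-component of an optimal solution of $$\min_{C,\tau}\ r^2\tau+\frac{\sigma^2}{n_S}\operatorname{Tr}(C\hat\Sigma_S^{-1}C^\top\hat\Sigma_U)\quad\text{s.t.}\quad (C-I)^\top\hat\Sigma_U(C-I)\preceq\tau I,$$ and $\hat{\boldsymbol{\beta}}(\mathbf{y}_S):=\hat C\hat\Sigma_S^{-1}X_S^\top\mathbf{y}_S/n_S$. Define $L_{\mathcal{B}}(\hat{\boldsymbol{\beta}}):=\max_{\boldsymbol{\beta}^*\in\mathcal{B}}\mathbb{E}_{\mathbf{z}}\mathbb{E}_{\mathbf{x}\sim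 p_T}(\mathbf{x}^\top(\hat{\boldsymbol{\beta}}(\mathbf{y}_S)-\boldsymbol{\beta}^* ))^2$ (with $X_S$ held fixed). Further let $\mathbf{y}_R:=\Sigma_S^{1/2}\boldsymbol{\beta}^*+\mathbf{z}_R$ with $\mathbf{z}_R\sim\mathcal{N}(0,\frac{\sigma^2}{n_S}I_d)$, and for an estimator $\boldsymbol{\beta}:\mathbb{R}^d\to\mathbb{R}^d$ define $L_{R,\mathcal{B}}(\boldsymbol{\beta}):=\max_{\boldsymbol{\beta}^*\in\mathcal{B}}\mathbb{E}_{\mathbf{z}_R}\mathbb{E}_{\mathbf{x}\sim p_T}(\mathbf{x}^\top(\boldsymbol{\beta}(\mathbf{y}_R)-\boldsymbol{\beta}^* ))^2$. Suppose $n_S,n_U\ge c_0\rho^4(d+\log(1/\delta))$ for a sufficiently large absolute constant $c_0$. Then with probability at least $1-\delta$ over $X_S$ and $X_U$, $$L_{\mathcal{B}}(\hat{\boldsymbol{\beta}})\le\Big(1+O\Big(\sqrt{\tfrac{\rho^4(d+\log(1/\delta))}{n_U}}\Big)+O\Big(\sqrt{\tfrac{\rho^4(d+\log(1/\delta))}{n_S}}\Big)\Big)\min_{A\in\mathbb{R}^{d\times d}}L_{R,\mathcal{B}}(\mathbf{y}_R\mapsto A\mathbf{y}_R),$$ where $O(\cdot)$ hides absolute constants.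
   Context: A mean-zero distribution $p$ on $\mathbb{R}^d$ with second-moment matrix $\Sigma$ is $\rho^2$-subgaussian if the whitened vector $\bar{\mathbf{x}}=\Sigma^{-1/2}\mathbf{x}$ ($\mathbf{x}\sim p$) satisfies $\mathbb{E}[e^{s\,\mathbf{v}^\top(\bar{\mathbf{x}}-\mathbb{E}\bar{\mathbf{x}})}]\le e^{s^2\rho^2/2}$ for all unit vectors $\mathbf{v}$ and all $s\in\mathbb{R}$. The linear estimators in $\mathbf{y}_R$ may depend on $\Sigma_S,\Sigma_T$ (an oracle with access to the population source covariance). *)

theory Defs
  imports "HOL-Probability.Probability"
begin

text \<open>Explicit-dimension linear algebra: vectors in R^d are functions nat => real
  (only indices < d matter), matrices are nat => nat => real.\<close>

definition dotp :: "nat \<Rightarrow> (nat \<Rightarrow> real) \<Rightarrow> (nat \<Rightarrow> real) \<Rightarrow> real" where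
  "dotp n x y = (\<Sum>i<n. x i * y i)"

definition mv :: "nat \<Rightarrow> (nat \<Rightarrow> nat \<Rightarrow> real) \<Rightarrow> (nat \<Rightarrow> real) \<Rightarrow> (nat \<Rightarrow> real)" where
  "mv n A x = (\<lambda>i. \<Sum>j<n. A i j * x j)"

definition mmul :: "nat \<Rightarrow> (nat \<Rightarrow> nat \<Rightarrow> real) \<Rightarrow> (nat \<Rightarrow> nat \<Rightarrow> real) \<Rightarrow> (nat \<Rightarrow> nat \<Rightarrow> real)" where
  "mmul n A B = (\<lambda>i j. \<Sum>k<n. A i k * B k j)"

definition transp :: "(nat \<Rightarrow> nat \<Rightarrow> real) \<Rightarrow> (nat \<Rightarrow> nat \<Rightarrow> real)" where
  "transp A = (\<lambda>i j. A j i)"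

definition idm :: "nat \<Rightarrow> nat \<Rightarrow> real" where
  "idm = (\<lambda>i j. if i = j then 1 else 0)"

definition mtrace :: "nat \<Rightarrow> (nat \<Rightarrow> nat \<Rightarrow> real) \<Rightarrow> real" where
  "mtrace d A = (\<Sum>i<d. A i i)"

text \<open>d x d matrix with zero entries outside the index range (used for uniqueness).\<close>
definition mat_ext :: "nat \<Rightarrow> (nat \<Rightarrow> nat \<Rightarrow> real) \<Rightarrow> bool" where
  "mat_ext d A \<longleftrightarrow> (\<forall>i j. (d \<le> i \<or> d \<le> j) \<longrightarrow> A i j = 0)"

definition msym :: "nat \<Rightarrow> (nat \<Rightarrow> nat \<Rightarrow> real) \<Rightarrow> bool" where
  "msym d A \<longleftrightarrow> (\<forall>i<d. \<forall>j<d. A i j = A j i)"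

definition psd :: "nat \<Rightarrow> (nat \<Rightarrow> nat \<Rightarrow> real) \<Rightarrow> bool" where
  "psd d A \<longleftrightarrow> msym d A \<and> (\<forall>x. 0 \<le> dotp d x (mv d A x))"

definition loewner_le :: "nat \<Rightarrow> (nat \<Rightarrow> nat \<Rightarrow> real) \<Rightarrow> (nat \<Rightarrow> nat \<Rightarrow> real) \<Rightarrow> bool" where
  "loewner_le d A B \<longleftrightarrow> psd d (\<lambda>i j. B i j - A i j)"

definition minvertible :: "nat \<Rightarrow> (nat \<Rightarrow> nat \<Rightarrow> real) \<Rightarrow> bool" where
  "minvertible d A \<longleftrightarrow> (\<exists>B. \<forall>i<d. \<forall>j<d. mmul d A B i j = idm i j \<and> mmul d B A i j = idm i j)"

definition msqrt :: "nat \<Rightarrow> (nat \<Rightarrow> nat \<Rightarrow> real) \<Rightarrow> (nat \<Rightarrow> nat \<Rightarrow> real)" where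
  "msqrt d A = (THE B. mat_ext d B \<and> psd d B \<and> (\<forall>i<d. \<forall>j<d. mmul d B B i j = A i j))"

text \<open>Moore-Penrose pseudo-inverse; equals the inverse for invertible matrices.\<close>
definition pinv :: "nat \<Rightarrow> (nat \<Rightarrow> nat \<Rightarrow> real) \<Rightarrow> (nat \<Rightarrow> nat \<Rightarrow> real)" where
  "pinv d A = (THE B. mat_ext d B \<and>
     (\<forall>i<d. \<forall>j<d. mmul d (mmul d A B) A i j = A i j) \<and>
     (\<forall>i<d. \<forall>j<d. mmul d (mmul d B A) B i j = B i j) \<and>
     msym d (mmul d A B) \<and> msym d (mmul d B A))"

definition vec_dist :: "nat \<Rightarrow> (nat \<Rightarrow> real) measure \<Rightarrow> bool" where
  "vec_dist d p \<longleftrightarrow> prob_space p \<and> sets p = sets (PiM {..<d} (\<lambda>_. (borel :: real measure)))"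

definition mean_zero :: "nat \<Rightarrow> (nat \<Rightarrow> real) measure \<Rightarrow> bool" where
  "mean_zero d p \<longleftrightarrow> (\<forall>i<d. integrable p (\<lambda>x. x i) \<and> (\<integral>x. x i \<partial>p) = 0)"

definition finite_second_moments :: "nat \<Rightarrow> (nat \<Rightarrow> real) measure \<Rightarrow> bool" where
  "finite_second_moments d p \<longleftrightarrow> (\<forall>i<d. \<forall>j<d. integrable p (\<lambda>x. x i * x j))"

definition smom :: "(nat \<Rightarrow> real) measure \<Rightarrow> (nat \<Rightarrow> nat \<Rightarrow> real)" where
  "smom p = (\<lambda>i j. \<integral>x. x i * x j \<partial>p)"

text \<open>rho^2-subgaussian: whitened vector Sigma^{-1/2} x (pseudo-inverse if Sigma is singular).\<close>
definition subgaussian :: "nat \<Rightarrow> real \<Rightarrow> (nat \<Rightarrow> real) measure \<Rightarrow> bool" where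
  "subgaussian d \<rho> p \<longleftrightarrow>
     (let W = msqrt d (pinv d (smom p));
          m = (\<lambda>i. \<integral>x. mv d W x i \<partial>p)
      in \<forall>v s. dotp d v v = 1 \<longrightarrow>
           (\<integral>\<^sup>+x. ennreal (exp (s * dotp d v (\<lambda>i. mv d W x i - m i))) \<partial>p)
             \<le> ennreal (exp (s\<^sup>2 * \<rho>\<^sup>2 / 2)))"

definition covhat :: "nat \<Rightarrow> (nat \<Rightarrow> nat \<Rightarrow> real) \<Rightarrow> (nat \<Rightarrow> nat \<Rightarrow> real)" where
  "covhat n X = (\<lambda>i j. (\<Sum>k<n. X k i * X k j) / real n)"

definition gauss :: "nat \<Rightarrow> real \<Rightarrow> (nat \<Rightarrow> real) measure" where
  "gauss n s = PiM {..<n} (\<lambda>_. density lborel (normal_density 0 s))"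

definition sdp_obj :: "nat \<Rightarrow> real \<Rightarrow> real \<Rightarrow> nat \<Rightarrow> (nat \<Rightarrow> nat \<Rightarrow> real) \<Rightarrow> (nat \<Rightarrow> nat \<Rightarrow> real)
     \<Rightarrow> (nat \<Rightarrow> nat \<Rightarrow> real) \<Rightarrow> real \<Rightarrow> real" where
  "sdp_obj d r \<sigma> nS SS SU C \<tau> =
     r\<^sup>2 * \<tau> + \<sigma>\<^sup>2 / real nS * mtrace d (mmul d (mmul d (mmul d C (pinv d SS)) (transp C)) SU)"

definition sdp_feasible :: "nat \<Rightarrow> (nat \<Rightarrow> nat \<Rightarrow> real) \<Rightarrow> (nat \<Rightarrow> nat \<Rightarrow> real) \<Rightarrow> real \<Rightarrow> bool" where
  "sdp_feasible d SU C \<tau> \<longleftrightarrow>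
     (let D = (\<lambda>i j. C i j - idm i j)
      in loewner_le d (mmul d (mmul d (transp D) SU) D) (\<lambda>i j. \<tau> * idm i j))"

definition sdp_optimal :: "nat \<Rightarrow> real \<Rightarrow> real \<Rightarrow> nat \<Rightarrow> (nat \<Rightarrow> nat \<Rightarrow> real) \<Rightarrow> (nat \<Rightarrow> nat \<Rightarrow> real)
     \<Rightarrow> (nat \<Rightarrow> nat \<Rightarrow> real) \<Rightarrow> real \<Rightarrow> bool" where
  "sdp_optimal d r \<sigma> nS SS SU C \<tau> \<longleftrightarrow> sdp_feasible d SU C \<tau> \<and>
     (\<forall>C' \<tau>'. sdp_feasible d SU C' \<tau>' \<longrightarrow> sdp_obj d r \<sigma> nS SS SU C \<tau> \<le> sdp_obj d r \<sigma> nS SS SU C' \<tau>')"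

definition betahat :: "nat \<Rightarrow> nat \<Rightarrow> (nat \<Rightarrow> nat \<Rightarrow> real) \<Rightarrow> (nat \<Rightarrow> nat \<Rightarrow> real) \<Rightarrow> (nat \<Rightarrow> real) \<Rightarrow> (nat \<Rightarrow> real)" where
  "betahat d nS XS C y = mv d (mmul d C (pinv d (covhat nS XS))) (\<lambda>j. (\<Sum>k<nS. XS k j * y k) / real nS)"

definition ball_B :: "nat \<Rightarrow> real \<Rightarrow> (nat \<Rightarrow> real) set" where
  "ball_B d r = {\<beta>. dotp d \<beta> \<beta> \<le> r\<^sup>2}"

definition loss_B :: "nat \<Rightarrow> nat \<Rightarrow> real \<Rightarrow> real \<Rightarrow> (nat \<Rightarrow> real) measure \<Rightarrow> (nat \<Rightarrow> nat \<Rightarrow> real)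
     \<Rightarrow> ((nat \<Rightarrow> real) \<Rightarrow> (nat \<Rightarrow> real)) \<Rightarrow> ennreal" where
  "loss_B d nS \<sigma> r pT XS est =
     (SUP \<beta>\<in>ball_B d r.
        \<integral>\<^sup>+z. (\<integral>\<^sup>+x. ennreal ((dotp d x (\<lambda>i. est (\<lambda>k. dotp d (XS k) \<beta> + z k) i - \<beta> i))\<^sup>2) \<partial>pT)
          \<partial>gauss nS \<sigma>)"

definition loss_R :: "nat \<Rightarrow> nat \<Rightarrow> real \<Rightarrow> real \<Rightarrow> (nat \<Rightarrow> real) measure \<Rightarrow> (nat \<Rightarrow> nat \<Rightarrow> real)
     \<Rightarrow> ((nat \<Rightarrow> real) \<Rightarrow> (nat \<Rightarrow> real)) \<Rightarrow> ennreal" where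
  "loss_R d nS \<sigma> r pT SigS est =
     (SUP \<beta>\<in>ball_B d r.
        \<integral>\<^sup>+z. (\<integral>\<^sup>+x. ennreal ((dotp d x (\<lambda>i. est (\<lambda>j. mv d (msqrt d SigS) \<beta> j + z j) i - \<beta> i))\<^sup>2) \<partial>pT)
          \<partial>gauss d (\<sigma> / sqrt (real nS)))"

end

theory Submission
  imports Defs
begin

text \<open>
  For a linear estimator the worst-case risk over the ball splits into a bias term and a trace, so the
  semidefinite objective is that risk with \<open>\<Sigma>\<^sub>T\<close>, \<open>\<Sigma>\<^sub>S\<close> replaced by their empirical versions, and the oracle
  \<open>A y\<^sub>R\<close> corresponds to the candidate \<open>C = A \<Sigma>\<^sub>S\<^bsup>1/2\<^esup>\<close>. If the empirical matrices agree with the population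
  ones up to relative errors \<open>\<epsilon>\<^sub>S, \<epsilon>\<^sub>U \<le> 1/2\<close> in the Loewner order, exchanging them at the optimum and at the
  candidate costs a factor \<open>(1 + \<epsilon>\<^sub>U) / ((1 - \<epsilon>\<^sub>U) (1 - \<epsilon>\<^sub>S)) \<le> 1 + 8 \<epsilon>\<^sub>U + 2 \<epsilon>\<^sub>S\<close>.

  The relative errors are controlled by a Chernoff bound for the squares of the whitened marginals and a
  union bound over the points of \<open>(4 \<surd>d)\<^sup>-\<^sup>1 \<int>\<^sup>d\<close> of norm at most \<open>5/4\<close>. There are at most \<open>e\<^bsup>27 d\<^esup>\<close> of them,
  because \<open>1 \<le> e\<^bsup>25 d - |z|\<^sup>2\<^esup>\<close> for the corresponding integer vectors \<open>z\<close> and the right-hand side factorises.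
\<close>

section \<open>Linear algebra with explicit dimensions\<close>

definition bform :: "nat \<Rightarrow> (nat \<Rightarrow> nat \<Rightarrow> real) \<Rightarrow> (nat \<Rightarrow> real) \<Rightarrow> (nat \<Rightarrow> real) \<Rightarrow> real" where
  "bform d A x y = dotp d x (mv d A y)"

lemma bform_altdef: "bform d A x y = (\<Sum>i<d. \<Sum>j<d. x i * A i j * y j)"
  by (simp add: bform_def dotp_def mv_def sum_distrib_left mult.assoc)

lemma dotp_nonneg: "0 \<le> dotp d x x"
  unfolding dotp_def by (intro sum_nonneg) auto

lemma dotp_commute: "dotp d x y = dotp d y x"
  unfolding dotp_def by (simp add: mult.commute)

lemma dotp_self_eq_0_iff: "dotp d x x = 0 \<longleftrightarrow> (\<forall>i<d. x i = 0)"
  unfolding dotp_def by (subst sum_nonneg_eq_0_iff) auto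

lemma dotp_cong:
  "(\<And>i. i < d \<Longrightarrow> x i = x' i) \<Longrightarrow> (\<And>i. i < d \<Longrightarrow> y i = y' i) \<Longrightarrow> dotp d x y = dotp d x' y'"
  unfolding dotp_def by (intro sum.cong) auto

lemma dotp_linear_right:
  "dotp d z (\<lambda>i. a * x i + b * y i) = a * dotp d z x + b * dotp d z y"
  unfolding dotp_def
  by (simp add: sum_distrib_left sum.distrib algebra_simps)

lemma dotp_linear_left:
  "dotp d (\<lambda>i. a * x i + b * y i) z = a * dotp d x z + b * dotp d y z"
  using dotp_linear_right[of d z a x b y] by (simp add: dotp_commute)

lemma dotp_scale_right: "dotp d x (\<lambda>i. a * y i) = a * dotp d x y"
  and dotp_scale_left: "dotp d (\<lambda>i. a * x i) y = a * dotp d x y"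
  and dotp_diff_right: "dotp d x (\<lambda>i. y i - z i) = dotp d x y - dotp d x z"
  and dotp_sum_right: "dotp d x (\<lambda>i. \<Sum>k\<in>K. w k i) = (\<Sum>k\<in>K. dotp d x (w k))"
  unfolding dotp_def
  by (simp_all add: sum_distrib_left mult_ac right_diff_distrib sum_subtractf) (rule sum.swap)

lemma dotp_lincomb_self:
  "dotp d (\<lambda>i. a * x i + b * y i) (\<lambda>i. a * x i + b * y i)
     = a\<^sup>2 * dotp d x x + 2 * a * b * dotp d x y + b\<^sup>2 * dotp d y y"
  by (simp add: dotp_linear_right dotp_linear_left dotp_commute[of d y x] power2_eq_square algebra_simps)

lemma mv_linear: "mv d A (\<lambda>i. a * x i + b * y i) = (\<lambda>i. a * mv d A x i + b * mv d A y i)"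
  unfolding mv_def by (auto simp: sum_distrib_left sum.distrib algebra_simps)

lemma mv_cong: "(\<And>j. j < d \<Longrightarrow> A i j = B i j) \<Longrightarrow> (\<And>j. j < d \<Longrightarrow> x j = y j) \<Longrightarrow> mv d A x i = mv d B y i"
  unfolding mv_def by (intro sum.cong) auto

lemma dotp_mv: "dotp n x (mv m A y) = dotp m (mv n (transp A) x) y"
  unfolding dotp_def mv_def transp_def
  by (simp add: sum_distrib_left sum_distrib_right, subst sum.swap) (simp add: mult_ac)

lemma mv_mmul: "mv d (mmul n A B) x = mv n A (mv d B x)"
  unfolding mv_def mmul_def
  by (rule ext) (simp add: sum_distrib_left sum_distrib_right, subst sum.swap, simp add: mult_ac)

lemma mmul_assoc: "mmul n (mmul m A B) C = mmul m A (mmul n B C)"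
  unfolding mmul_def
  by (intro ext) (simp add: sum_distrib_left sum_distrib_right, subst sum.swap, simp add: mult_ac)

lemma transp_mmul: "transp (mmul n A B) = mmul n (transp B) (transp A)"
  unfolding mmul_def transp_def by (simp add: mult.commute)

lemma transp_transp [simp]: "transp (transp A) = A"
  by (simp add: transp_def)

lemma mtrace_mmul_commute: "mtrace d (mmul d A B) = mtrace d (mmul d B A)"
  unfolding mtrace_def mmul_def by (subst sum.swap) (simp add: mult.commute)

lemma mtrace_congruence: "mtrace d (mmul d (transp B) (mmul d A B)) = (\<Sum>k<d. bform d A (\<lambda>i. B i k) (\<lambda>i. B i k))"
  unfolding mtrace_def mmul_def transp_def bform_def dotp_def mv_def by simp

lemma mmul_cong:
  "(\<And>k. k < n \<Longrightarrow> A i k = A' i k) \<Longrightarrow> (\<And>k. k < n \<Longrightarrow> B k j = B' k j) \<Longrightarrow> mmul n A B i j = mmul n A' B' i j"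
  unfolding mmul_def by (intro sum.cong) auto

lemma mmul_idm_left: "i < d \<Longrightarrow> mmul d idm A i j = A i j"
  unfolding mmul_def idm_def by (simp add: if_distrib[of "\<lambda>x. x * _"] sum.delta cong: if_cong)

lemma mmul_idm_right: "j < d \<Longrightarrow> mmul d A idm i j = A i j"
  unfolding mmul_def idm_def by (simp add: if_distrib[of "\<lambda>x. _ * x"] sum.delta cong: if_cong)

lemma mv_idm: "i < d \<Longrightarrow> mv d idm x i = x i"
  unfolding mv_def idm_def by (simp add: if_distrib[of "\<lambda>x. x * _"] sum.delta cong: if_cong)

lemma bform_cong:
  "(\<And>i j. i < d \<Longrightarrow> j < d \<Longrightarrow> A i j = B i j) \<Longrightarrow> (\<And>i. i < d \<Longrightarrow> x i = x' i) \<Longrightarrow> (\<And>i. i < d \<Longrightarrow> y i = y' i)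
   \<Longrightarrow> bform d A x y = bform d B x' y'"
  unfolding bform_altdef by (intro sum.cong refl) auto

lemma bform_commute: "msym d A \<Longrightarrow> bform d A x y = bform d A y x"
  unfolding bform_altdef msym_def by (subst sum.swap) (intro sum.cong refl, auto)

lemma bform_linear_right: "bform d A z (\<lambda>i. a * x i + b * y i) = a * bform d A z x + b * bform d A z y"
  by (simp add: bform_def mv_linear dotp_linear_right)

lemma bform_linear_left: "bform d A (\<lambda>i. a * x i + b * y i) z = a * bform d A x z + b * bform d A y z"
  by (simp add: bform_def dotp_linear_left)

lemma bform_scale: "bform d A (\<lambda>i. a * x i) (\<lambda>i. a * x i) = a\<^sup>2 * bform d A x x"
  unfolding bform_altdef by (simp add: sum_distrib_left power2_eq_square mult_ac)

lemma bform_lincomb_self: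
  assumes "msym d A"
  shows "bform d A (\<lambda>i. a * x i + b * y i) (\<lambda>i. a * x i + b * y i)
     = a\<^sup>2 * bform d A x x + 2 * a * b * bform d A x y + b\<^sup>2 * bform d A y y"
  using bform_commute[OF assms, of y x]
  by (simp add: bform_linear_right bform_linear_left power2_eq_square algebra_simps)

lemma bform_mv: "bform d A (mv m B x) (mv m B y) = bform m (mmul d (transp B) (mmul d A B)) x y"
  by (simp add: bform_def mv_mmul dotp_mv)

lemma psd_bform: "psd d A \<longleftrightarrow> msym d A \<and> (\<forall>x. 0 \<le> bform d A x x)"
  by (simp add: psd_def bform_def)

section \<open>Spectral decomposition\<close>

lemma exists_orthogonal_unit_vector:
  assumes "k < d" and orth: "\<And>i j. i < k \<Longrightarrow> j < k \<Longrightarrow> dotp d (u i) (u j) = idm i j"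
  shows "\<exists>x. dotp d x x = 1 \<and> (\<forall>i<k. dotp d (u i) x = 0) \<and> (\<forall>a\<ge>d. x a = 0)"
proof -
  define e where "e j = (\<lambda>a. if a = j then 1 else (0::real))" for j :: nat
  define w where "w j = (\<lambda>a. e j a - (\<Sum>i<k. u i j * u i a))" for j
  have ue: "dotp d z (e j) = z j" if "j < d" for j z
    using that unfolding dotp_def e_def by (simp add: if_distrib[of "\<lambda>x. _ * x"] sum.delta cong: if_cong)
  have uw: "dotp d (u i) (w j) = 0" if "i < k" "j < d" for i j
  proof -
    have "dotp d (u i) (w j) = u i j - (\<Sum>l<k. u l j * idm i l)"
      using that unfolding w_def dotp_diff_right dotp_sum_right dotp_scale_right ue[OF \<open>j < d\<close>]
      by (simp add: orth)
    also have "(\<Sum>l<k. u l j * idm i l) = u i j"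
      using that unfolding idm_def by (simp add: if_distrib[of "\<lambda>x. _ * x"] sum.delta cong: if_cong)
    finally show ?thesis by simp
  qed
  have ww: "dotp d (w j) (w j) = 1 - (\<Sum>i<k. (u i j)\<^sup>2)" if "j < d" for j
  proof -
    have "dotp d (w j) (w j) = dotp d (w j) (e j) - (\<Sum>i<k. u i j * dotp d (w j) (u i))"
      by (subst (2) w_def) (simp add: dotp_diff_right dotp_sum_right dotp_scale_right)
    also have "\<dots> = w j j" using that by (simp add: ue dotp_commute[of d "w j" "u _"] uw)
    also have "\<dots> = 1 - (\<Sum>i<k. (u i j)\<^sup>2)" by (simp add: w_def e_def power2_eq_square)
    finally show ?thesis .
  qed
  have "(\<Sum>j<d. dotp d (w j) (w j)) = real d - (\<Sum>j<d. \<Sum>i<k. (u i j)\<^sup>2)"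
    by (simp add: ww sum_subtractf)
  also have "(\<Sum>j<d. \<Sum>i<k. (u i j)\<^sup>2) = (\<Sum>i<k. dotp d (u i) (u i))"
    by (subst sum.swap) (simp add: dotp_def power2_eq_square)
  also have "\<dots> = real k" by (simp add: orth idm_def)
  finally have "(\<Sum>j<d. dotp d (w j) (w j)) \<noteq> 0" using assms(1) by simp
  then obtain j where j: "j < d" "dotp d (w j) (w j) \<noteq> 0" by (meson lessThan_iff sum.not_neutral_contains_not_neutral)
  have pos: "dotp d (w j) (w j) > 0" using j(2) dotp_nonneg[of d "w j"] by simp
  define c where "c = 1 / sqrt (dotp d (w j) (w j))"
  define x where "x = (\<lambda>a. if a < d then c * w j a else 0)"
  have "dotp d x x = dotp d (\<lambda>a. c * w j a) (\<lambda>a. c * w j a)" by (rule dotp_cong) (auto simp: x_def)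
  also have "\<dots> = 1" using pos unfolding dotp_scale_left dotp_scale_right c_def by (simp add: field_simps)
  finally have 1: "dotp d x x = 1" .
  have "dotp d (u i) x = 0" if "i < k" for i
  proof -
    have "dotp d (u i) x = dotp d (u i) (\<lambda>a. c * w j a)" by (rule dotp_cong) (auto simp: x_def)
    then show ?thesis using uw[OF that j(1)] by (simp add: dotp_scale_right)
  qed
  with 1 show ?thesis by (intro exI[of _ x]) (auto simp: x_def)
qed

lemma complete_orthonormal:
  assumes orth: "\<And>i j. i < d \<Longrightarrow> j < d \<Longrightarrow> dotp d (u i) (u j) = idm i j" and "a < d" "b < d"
  shows "(\<Sum>i<d. u i a * u i b) = idm a b"
proof -
  define U where "U = (\<lambda>i j. (\<Sum>l<d. u l i * u l j) :: real)"
  have UU: "mmul d U U i j = U i j" for i j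
  proof -
    have "mmul d U U i j = (\<Sum>k<d. \<Sum>l<d. \<Sum>m<d. u l i * u m j * (u l k * u m k))"
      unfolding mmul_def U_def sum_product by (simp add: mult_ac)
    also have "\<dots> = (\<Sum>l<d. \<Sum>m<d. \<Sum>k<d. u l i * u m j * (u l k * u m k))"
      by (subst sum.swap) (intro sum.cong refl sum.swap)
    also have "\<dots> = (\<Sum>l<d. \<Sum>m<d. u l i * u m j * idm l m)"
      using orth unfolding dotp_def by (simp add: sum_distrib_left[symmetric])
    also have "\<dots> = U i j"
      unfolding idm_def U_def by (simp add: if_distrib[of "\<lambda>x. _ * x"] sum.delta cong: if_cong)
    finally show ?thesis .
  qed
  have sym: "U i j = U j i" for i j unfolding U_def by (simp add: mult.commute)
  have tr: "(\<Sum>i<d. U i i) = real d"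
  proof -
    have "(\<Sum>i<d. U i i) = (\<Sum>l<d. dotp d (u l) (u l))"
      unfolding U_def dotp_def by (rule sum.swap)
    then show ?thesis by (simp add: orth idm_def)
  qed
  have "(\<Sum>i<d. \<Sum>j<d. (idm i j - U i j)\<^sup>2) = (\<Sum>i<d. 1 - U i i)"
  proof (rule sum.cong[OF refl])
    fix i assume "i \<in> {..<d}"
    have "(\<Sum>j<d. (idm i j - U i j)\<^sup>2) = (\<Sum>j<d. idm i j * (1 - 2 * U i j)) + (\<Sum>j<d. U i j * U j i)"
      unfolding sum.distrib[symmetric]
      by (intro sum.cong refl) (auto simp: idm_def power2_eq_square algebra_simps sym[of _ i])
    also have "(\<Sum>j<d. idm i j * (1 - 2 * U i j)) = 1 - 2 * U i i"
      using \<open>i \<in> {..<d}\<close> unfolding idm_def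
      by (simp add: if_distrib[of "\<lambda>x. x * _"] sum.delta cong: if_cong)
    also have "(\<Sum>j<d. U i j * U j i) = U i i" using UU[of i i] by (simp add: mmul_def)
    finally show "(\<Sum>j<d. (idm i j - U i j)\<^sup>2) = 1 - U i i" by simp
  qed
  also have "\<dots> = 0" using tr by (simp add: sum_subtractf)
  finally have "\<forall>i\<in>{..<d}. (\<Sum>j<d. (idm i j - U i j)\<^sup>2) = 0"
    by (subst (asm) sum_nonneg_eq_0_iff) (auto intro!: sum_nonneg)
  then have "(\<Sum>j<d. (idm a j - U a j)\<^sup>2) = 0" using assms by auto
  then have "(idm a b - U a b)\<^sup>2 = 0" using assms by (subst (asm) sum_nonneg_eq_0_iff) auto
  then show ?thesis by (simp add: U_def)
qed

lemma continuous_on_coordinate: "continuous_on S (\<lambda>x::nat \<Rightarrow> real. x i)"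
  by (rule continuous_on_subset[OF continuous_on_product_coordinates]) auto

lemma compact_unit_vectors:
  "compact {x. dotp d x x = 1 \<and> (\<forall>i<k. dotp d (u i) x = 0) \<and> (\<forall>a\<ge>d. x a = (0::real))}" (is "compact ?S")
proof -
  define B :: "(nat \<Rightarrow> real) set" where "B = PiE UNIV (\<lambda>i. if i < d then {-1..1} else {0})"
  have "compactin (product_topology (\<lambda>i::nat. euclidean :: real topology) UNIV) B"
    unfolding B_def compactin_PiE by (auto simp: compactin_euclidean_iff)
  then have cB: "compact B" by (simp add: euclidean_product_topology compactin_euclidean_iff)
  have cl: "closed {x :: nat \<Rightarrow> real. f x = c}" if "continuous_on UNIV f" for f :: "_ \<Rightarrow> real" and c
    using continuous_closed_preimage_constant[OF that closed_UNIV, of c] by simp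
  have "closed ?S"
    unfolding dotp_def
    by (intro closed_Collect_conj closed_Collect_all closed_Collect_imp open_Collect_const cl
        continuous_on_sum continuous_on_mult continuous_on_coordinate continuous_on_const)
  moreover have "?S \<subseteq> B"
  proof
    fix x assume x: "x \<in> ?S"
    have "x i \<in> {-1..1}" if "i < d" for i
    proof -
      have "(x i)\<^sup>2 \<le> (\<Sum>j<d. (x j)\<^sup>2)" using that by (intro member_le_sum) auto
      also have "\<dots> = 1" using x by (simp add: dotp_def power2_eq_square)
      finally show ?thesis by (simp add: abs_square_le_1 abs_le_iff)
    qed
    then show "x \<in> B" using x by (auto simp: B_def PiE_def)
  qed
  ultimately have "compact (B \<inter> ?S)" using cB by (intro compact_Int_closed) auto
  then show ?thesis using \<open>?S \<subseteq> B\<close> by (simp add: Int_absorb1)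
qed

lemma exists_next_eigenvector:
  assumes sym: "msym d A" and "k < d"
    and orth: "\<And>i j. i < k \<Longrightarrow> j < k \<Longrightarrow> dotp d (u i) (u j) = idm i j"
    and eig: "\<And>i a. i < k \<Longrightarrow> a < d \<Longrightarrow> mv d A (u i) a = l i * u i a"
  shows "\<exists>x c. dotp d x x = 1 \<and> (\<forall>i<k. dotp d (u i) x = 0) \<and> (\<forall>a\<ge>d. x a = 0)
     \<and> (\<forall>a<d. mv d A x a = c * x a)"
proof -
  define S where "S = {x. dotp d x x = 1 \<and> (\<forall>i<k. dotp d (u i) x = 0) \<and> (\<forall>a\<ge>d. x a = (0::real))}"
  have "S \<noteq> {}" using exists_orthogonal_unit_vector[where u=u, OF \<open>k < d\<close> orth] by (auto simp: S_def)
  moreover have "compact S" unfolding S_def by (rule compact_unit_vectors)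
  moreover have "continuous_on S (\<lambda>x. bform d A x x)"
    unfolding bform_altdef
    by (intro continuous_on_sum continuous_on_mult continuous_on_coordinate continuous_on_const)
  ultimately have "\<exists>x\<in>S. \<forall>y\<in>S. bform d A y y \<le> bform d A x x"
    by (intro continuous_attains_sup)
  then obtain x where x: "x \<in> S" and max: "\<And>y. y \<in> S \<Longrightarrow> bform d A y y \<le> bform d A x x"
    by blast
  define c where "c = bform d A x x"
  have xx: "dotp d x x = 1" and ux: "\<And>i. i < k \<Longrightarrow> dotp d (u i) x = 0" and xd: "\<And>a. a \<ge> d \<Longrightarrow> x a = 0"
    using x by (auto simp: S_def)
  have bound: "bform d A y y \<le> c * dotp d y y"
    if "\<And>i. i < k \<Longrightarrow> dotp d (u i) y = 0" for y
  proof (cases "dotp d y y = 0")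
    case True
    then have "\<forall>i<d. y i = 0" by (simp add: dotp_self_eq_0_iff)
    then have "bform d A y y = 0" by (auto simp: bform_altdef)
    then show ?thesis using True by simp
  next
    case False
    then have pos: "dotp d y y > 0" using dotp_nonneg[of d y] by simp
    define s where "s = 1 / sqrt (dotp d y y)"
    define w where "w = (\<lambda>a. if a < d then s * y a else 0)"
    have s2: "s\<^sup>2 * dotp d y y = 1" using pos by (simp add: s_def field_simps)
    have "dotp d w w = dotp d (\<lambda>a. s * y a) (\<lambda>a. s * y a)" by (rule dotp_cong) (auto simp: w_def)
    then have "dotp d w w = 1" using s2 by (simp add: dotp_scale_left dotp_scale_right power2_eq_square)
    moreover have "dotp d (u i) w = 0" if "i < k" for i
    proof -
      have "dotp d (u i) w = dotp d (u i) (\<lambda>a. s * y a)" by (rule dotp_cong) (auto simp: w_def)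
      then show ?thesis using \<open>\<And>i. i < k \<Longrightarrow> dotp d (u i) y = 0\<close> that by (simp add: dotp_scale_right)
    qed
    ultimately have "w \<in> S" by (auto simp: S_def w_def)
    then have "bform d A w w \<le> c" unfolding c_def by (rule max)
    moreover have "bform d A w w = s\<^sup>2 * bform d A y y"
      unfolding bform_scale[symmetric] by (rule bform_cong) (auto simp: w_def)
    ultimately have "s\<^sup>2 * bform d A y y \<le> c * (s\<^sup>2 * dotp d y y)" using s2 by simp
    then have "s\<^sup>2 * bform d A y y \<le> s\<^sup>2 * (c * dotp d y y)" by (simp add: mult_ac)
    moreover have "s\<^sup>2 > 0" using pos by (simp add: s_def)
    ultimately show ?thesis by simp
  qed
  define g where "g = (\<lambda>a. 1 * mv d A x a + (- c) * x a)"
  have ug: "dotp d (u i) g = 0" if "i < k" for i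
  proof -
    have "dotp d (u i) (mv d A x) = bform d A x (u i)" using bform_commute[OF sym, of "u i" x] by (simp add: bform_def)
    also have "\<dots> = dotp d x (\<lambda>a. l i * u i a)" unfolding bform_def
      by (rule dotp_cong) (simp_all add: eig that)
    also have "\<dots> = 0" using ux[OF that] by (simp add: dotp_scale_right dotp_commute)
    finally show ?thesis unfolding g_def dotp_linear_right using ux[OF that] by simp
  qed
  have gg: "dotp d g g = bform d A x g - c * dotp d x g"
  proof -
    have "dotp d g g = 1 * dotp d g (mv d A x) + (- c) * dotp d g x"
      unfolding dotp_linear_right[symmetric] by (simp add: g_def)
    then show ?thesis
      using bform_commute[OF sym, of x g] dotp_commute[of d x g] by (simp add: bform_def)
  qed
  define M where "M = c * dotp d g g - bform d A g g"
  have var: "2 * t * dotp d g g \<le> t\<^sup>2 * M" for t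
  proof -
    let ?y = "\<lambda>a. 1 * x a + t * g a"
    have "dotp d (u i) ?y = 0" if "i < k" for i
      using ug[OF that] ux[OF that] by (simp only: dotp_linear_right)
    then have "bform d A ?y ?y \<le> c * dotp d ?y ?y" by (rule bound)
    moreover have "bform d A x g = dotp d g g + c * dotp d x g" using gg by simp
    ultimately show ?thesis unfolding bform_lincomb_self[OF sym] dotp_lincomb_self M_def
      by (simp add: c_def[symmetric] xx algebra_simps)
  qed
  have "dotp d g g = 0"
  proof (rule ccontr)
    assume "dotp d g g \<noteq> 0"
    then have pos: "dotp d g g > 0" using dotp_nonneg[of d g] by simp
    define t where "t = dotp d g g / (\<bar>M\<bar> + 1)"
    have t: "t > 0" using pos by (simp add: t_def)
    have "t * (2 * dotp d g g) \<le> t * (t * M)" using var[of t] by (simp add: power2_eq_square mult_ac)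
    then have "2 * dotp d g g \<le> t * M" using t by simp
    also have "\<dots> \<le> t * (\<bar>M\<bar> + 1)" using t by (intro mult_left_mono) auto
    also have "\<dots> = dotp d g g" by (simp add: t_def)
    finally show False using pos by simp
  qed
  then have "\<forall>a<d. mv d A x a = c * x a" by (auto simp: dotp_self_eq_0_iff g_def)
  with xx ux xd show ?thesis by blast
qed

theorem spectral_decomposition:
  assumes sym: "msym d A"
  shows "\<exists>u l. (\<forall>i<d. \<forall>j<d. dotp d (u i) (u j) = idm i j) \<and>
    (\<forall>i<d. \<forall>a<d. mv d A (u i) a = l i * u i a) \<and>
    (\<forall>a<d. \<forall>b<d. A a b = (\<Sum>i<d. l i * u i a * u i b))"
proof -
  have "k \<le> d \<Longrightarrow> \<exists>u l. (\<forall>i<k. \<forall>j<k. dotp d (u i) (u j) = idm i j) \<and>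
      (\<forall>i<k. \<forall>a<d. mv d A (u i) a = l i * u i a)" for k
  proof (induction k)
    case (Suc k)
    then have "k \<le> d" by simp
    from Suc.IH[OF this] obtain u l where u: "\<And>i j. i < k \<Longrightarrow> j < k \<Longrightarrow> dotp d (u i) (u j) = idm i j"
      "\<And>i a. i < k \<Longrightarrow> a < d \<Longrightarrow> mv d A (u i) a = l i * u i a" by blast
    have "\<exists>x c. dotp d x x = 1 \<and> (\<forall>i<k. dotp d (u i) x = 0) \<and> (\<forall>a\<ge>d. x a = 0)
        \<and> (\<forall>a<d. mv d A x a = c * x a)"
      using Suc.prems by (intro exists_next_eigenvector[where l=l] sym u) auto
    then obtain x c where x: "dotp d x x = 1" "\<And>i. i < k \<Longrightarrow> dotp d (u i) x = 0"
      "\<And>a. a < d \<Longrightarrow> mv d A x a = c * x a"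
      by blast
    have xu: "dotp d x (u i) = 0" if "i < k" for i using x(2)[OF that] by (simp add: dotp_commute)
    show ?case
    proof (intro exI conjI allI impI)
      fix i j assume "i < Suc k" "j < Suc k"
      then show "dotp d ((u(k := x)) i) ((u(k := x)) j) = idm i j"
        by (cases "i = k"; cases "j = k") (simp_all add: u(1) x(1,2) xu idm_def)
    next
      fix i a assume "i < Suc k" "a < d"
      then show "mv d A ((u(k := x)) i) a = (l(k := c)) i * (u(k := x)) i a"
        by (cases "i = k") (simp_all add: u(2) x(3))
    qed
  qed auto
  from this[of d] obtain u l where u: "\<And>i j. i < d \<Longrightarrow> j < d \<Longrightarrow> dotp d (u i) (u j) = idm i j"
      "\<And>i a. i < d \<Longrightarrow> a < d \<Longrightarrow> mv d A (u i) a = l i * u i a" by blast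
  have "A a b = (\<Sum>i<d. l i * u i a * u i b)" if "a < d" "b < d" for a b
  proof -
    have "A a b = mmul d A idm a b" using that by (simp add: mmul_idm_right)
    also have "\<dots> = mmul d A (\<lambda>c b. \<Sum>i<d. u i c * u i b) a b"
      using that by (intro mmul_cong refl) (simp add: complete_orthonormal[OF u(1)])
    also have "\<dots> = (\<Sum>i<d. mv d A (u i) a * u i b)"
      unfolding mmul_def mv_def sum_distrib_left sum_distrib_right by (subst sum.swap) (simp add: mult_ac)
    also have "\<dots> = (\<Sum>i<d. l i * u i a * u i b)" using that u(2) by simp
    finally show ?thesis .
  qed
  with u show ?thesis by blast
qed

section \<open>Pseudo-inverses and square roots\<close>

definition mtrunc :: "nat \<Rightarrow> (nat \<Rightarrow> nat \<Rightarrow> real) \<Rightarrow> nat \<Rightarrow> nat \<Rightarrow> real" where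
  "mtrunc d A = (\<lambda>i j. if i < d \<and> j < d then A i j else 0)"

lemma mtrunc_eq_iff: "mtrunc d A = mtrunc d B \<longleftrightarrow> (\<forall>i<d. \<forall>j<d. A i j = B i j)"
  unfolding mtrunc_def fun_eq_iff by auto

lemma mtrunc_mmul: "mtrunc d (mmul d A B) = mmul d (mtrunc d A) (mtrunc d B)"
  unfolding mtrunc_def mmul_def by (intro ext) auto

lemma mtrunc_transp: "mtrunc d (transp A) = transp (mtrunc d A)"
  unfolding mtrunc_def transp_def by (intro ext) auto

lemma mtrunc_mat_ext: "mat_ext d A \<Longrightarrow> mtrunc d A = A"
  unfolding mtrunc_def mat_ext_def by (intro ext) auto

lemma msym_iff_transp: "msym d A \<longleftrightarrow> transp (mtrunc d A) = mtrunc d A"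
  unfolding msym_def mtrunc_def transp_def fun_eq_iff by auto

definition is_pinv :: "nat \<Rightarrow> (nat \<Rightarrow> nat \<Rightarrow> real) \<Rightarrow> (nat \<Rightarrow> nat \<Rightarrow> real) \<Rightarrow> bool" where
  "is_pinv d A B \<longleftrightarrow> mat_ext d B \<and>
     (\<forall>i<d. \<forall>j<d. mmul d (mmul d A B) A i j = A i j) \<and>
     (\<forall>i<d. \<forall>j<d. mmul d (mmul d B A) B i j = B i j) \<and>
     msym d (mmul d A B) \<and> msym d (mmul d B A)"

lemma is_pinv_trunc:
  assumes "is_pinv d A B"
  defines "A' \<equiv> mtrunc d A"
  shows "mmul d A' (mmul d B A') = A'" "mmul d B (mmul d A' B) = B"
    "mmul d (transp B) (transp A') = mmul d A' B" "mmul d (transp A') (transp B) = mmul d B A'"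
proof -
  have B: "mtrunc d B = B" using assms(1) by (simp add: is_pinv_def mtrunc_mat_ext)
  show "mmul d A' (mmul d B A') = A'" "mmul d B (mmul d A' B) = B"
    "mmul d (transp B) (transp A') = mmul d A' B" "mmul d (transp A') (transp B) = mmul d B A'"
    using assms(1) unfolding is_pinv_def mtrunc_eq_iff[symmetric] msym_iff_transp
    by (simp_all add: mtrunc_mmul transp_mmul mmul_assoc B A'_def)
qed

lemma is_pinv_unique:
  assumes "is_pinv d A B" "is_pinv d A C"
  shows "B = C"
proof -
  define A' where "A' = mtrunc d A"
  note b = is_pinv_trunc[OF assms(1), folded A'_def] and c = is_pinv_trunc[OF assms(2), folded A'_def]
  have "mmul d A' B = mmul d (mmul d A' C) (mmul d A' B)"
    using c(1) by (simp add: mmul_assoc[symmetric])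
  also have "\<dots> = transp (mmul d (mmul d A' B) (mmul d A' C))"
    by (simp add: transp_mmul b(3) c(3))
  also have "mmul d (mmul d A' B) (mmul d A' C) = mmul d A' C"
    using b(1) by (simp add: mmul_assoc[symmetric])
  also have "transp (mmul d A' C) = mmul d A' C" by (simp add: transp_mmul c(3))
  finally have 1: "mmul d A' B = mmul d A' C" .
  have "mmul d B A' = mmul d (mmul d B A') (mmul d C A')"
    using c(1) by (simp add: mmul_assoc)
  also have "\<dots> = transp (mmul d (mmul d C A') (mmul d B A'))"
    by (simp add: transp_mmul b(4) c(4))
  also have "mmul d (mmul d C A') (mmul d B A') = mmul d C A'"
    using b(1) by (simp add: mmul_assoc)
  also have "transp (mmul d C A') = mmul d C A'" by (simp add: transp_mmul c(4))
  finally have 2: "mmul d B A' = mmul d C A'" .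
  have "B = mmul d B (mmul d A' C)" using b(2) 1 by simp
  also have "\<dots> = mmul d (mmul d C A') C" using 2 by (simp add: mmul_assoc[symmetric])
  also have "\<dots> = C" using c(2) by (simp add: mmul_assoc)
  finally show ?thesis .
qed

definition spec_mat :: "nat \<Rightarrow> (nat \<Rightarrow> nat \<Rightarrow> real) \<Rightarrow> (nat \<Rightarrow> real) \<Rightarrow> nat \<Rightarrow> nat \<Rightarrow> real" where
  "spec_mat d u f = mtrunc d (\<lambda>a b. \<Sum>i<d. f i * u i a * u i b)"

lemma mat_ext_spec_mat: "mat_ext d (spec_mat d u f)"
  by (auto simp: mat_ext_def spec_mat_def mtrunc_def)

lemma msym_spec_mat: "msym d (spec_mat d u f)"
  by (auto simp: msym_def spec_mat_def mtrunc_def mult_ac)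

lemma mmul_spec_mat:
  assumes orth: "\<And>i j. i < d \<Longrightarrow> j < d \<Longrightarrow> dotp d (u i) (u j) = idm i j"
  shows "mmul d (spec_mat d u f) (spec_mat d u g) = spec_mat d u (\<lambda>i. f i * g i)"
proof -
  have "mmul d (\<lambda>a b. \<Sum>i<d. f i * u i a * u i b) (\<lambda>a b. \<Sum>i<d. g i * u i a * u i b) a b
      = (\<Sum>i<d. f i * g i * u i a * u i b)" for a b
  proof -
    have "mmul d (\<lambda>a b. \<Sum>i<d. f i * u i a * u i b) (\<lambda>a b. \<Sum>i<d. g i * u i a * u i b) a b
        = (\<Sum>k<d. \<Sum>i<d. \<Sum>j<d. f i * g j * u i a * u j b * (u i k * u j k))"
      unfolding mmul_def sum_product by (simp add: mult_ac)
    also have "\<dots> = (\<Sum>i<d. \<Sum>j<d. \<Sum>k<d. f i * g j * u i a * u j b * (u i k * u j k))"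
      by (subst sum.swap) (intro sum.cong refl sum.swap)
    also have "\<dots> = (\<Sum>i<d. \<Sum>j<d. f i * g j * u i a * u j b * idm i j)"
      using orth unfolding dotp_def by (simp add: sum_distrib_left[symmetric])
    also have "\<dots> = (\<Sum>i<d. f i * g i * u i a * u i b)"
      unfolding idm_def by (simp add: if_distrib[of "\<lambda>x. _ * x"] sum.delta cong: if_cong)
    finally show ?thesis .
  qed
  then show ?thesis unfolding spec_mat_def mtrunc_mmul[symmetric] by presburger
qed

lemma bform_spec_mat: "bform d (spec_mat d u f) x x = (\<Sum>i<d. f i * (dotp d (u i) x)\<^sup>2)"
proof -
  have "bform d (spec_mat d u f) x x = (\<Sum>a<d. \<Sum>b<d. \<Sum>i<d. f i * ((u i a * x a) * (u i b * x b)))"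
    unfolding bform_altdef
    by (intro sum.cong refl) (auto simp: spec_mat_def mtrunc_def sum_distrib_left sum_distrib_right mult_ac)
  also have "\<dots> = (\<Sum>a<d. \<Sum>i<d. \<Sum>b<d. f i * ((u i a * x a) * (u i b * x b)))"
    by (intro sum.cong refl sum.swap)
  also have "\<dots> = (\<Sum>i<d. \<Sum>a<d. \<Sum>b<d. f i * ((u i a * x a) * (u i b * x b)))"
    by (rule sum.swap)
  also have "\<dots> = (\<Sum>i<d. f i * (dotp d (u i) x)\<^sup>2)"
    unfolding dotp_def power2_eq_square sum_product by (simp add: sum_distrib_left)
  finally show ?thesis .
qed

lemma psd_spec_mat: "(\<And>i. i < d \<Longrightarrow> 0 \<le> f i) \<Longrightarrow> psd d (spec_mat d u f)"
  unfolding psd_bform bform_spec_mat by (auto intro!: sum_nonneg msym_spec_mat)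

lemma spectral_decomposition_spec_mat:
  assumes "msym d A"
  shows "\<exists>u l. (\<forall>i<d. \<forall>j<d. dotp d (u i) (u j) = idm i j) \<and>
    (\<forall>i<d. \<forall>a<d. mv d A (u i) a = l i * u i a) \<and> mtrunc d A = spec_mat d u l"
  using spectral_decomposition[OF assms] unfolding spec_mat_def mtrunc_eq_iff .

lemma is_pinv_pinv:
  assumes "msym d A"
  shows "is_pinv d A (pinv d A)"
proof -
  obtain u l where orth: "\<And>i j. i < d \<Longrightarrow> j < d \<Longrightarrow> dotp d (u i) (u j) = idm i j"
    and "\<And>i a. i < d \<Longrightarrow> a < d \<Longrightarrow> mv d A (u i) a = l i * u i a"
    and A: "mtrunc d A = spec_mat d u l"
    using spectral_decomposition_spec_mat[OF assms] by blast
  \<comment> \<open>\<open>1 / 0 = 0\<close> inverts exactly the nonzero eigenvalues.\<close>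
  define B where "B = spec_mat d u (\<lambda>i. 1 / l i)"
  have B: "mtrunc d B = B" "mat_ext d B" by (auto simp: B_def mat_ext_spec_mat mtrunc_mat_ext)
  have mm: "mmul d (spec_mat d u f) (spec_mat d u g) = spec_mat d u (\<lambda>i. f i * g i)" for f g
    by (intro mmul_spec_mat orth)
  have l: "(\<lambda>i. l i * (1 / l i) * l i) = l" "(\<lambda>i. 1 / l i * l i * (1 / l i)) = (\<lambda>i. 1 / l i)"
    by (auto simp: fun_eq_iff)
  have "is_pinv d A B"
    unfolding is_pinv_def mtrunc_eq_iff[symmetric] msym_iff_transp mtrunc_mmul
    unfolding A B(1) unfolding B_def mm l
    using msym_spec_mat[unfolded msym_iff_transp] mat_ext_spec_mat
    by (simp add: mtrunc_mat_ext)
  then have "is_pinv d A (THE B. is_pinv d A B)"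
    by (rule theI[of "is_pinv d A"]) (rule is_pinv_unique[OF _ \<open>is_pinv d A B\<close>])
  then show ?thesis unfolding pinv_def is_pinv_def[symmetric] .
qed

lemma msym_pinv:
  assumes "msym d A"
  shows "transp (pinv d A) = pinv d A"
proof (rule is_pinv_unique[OF _ is_pinv_pinv[OF assms]])
  let ?B = "pinv d A"
  have B: "is_pinv d A ?B" by (rule is_pinv_pinv[OF assms])
  have e: "mtrunc d ?B = ?B" "mat_ext d ?B" using B by (auto simp: is_pinv_def mtrunc_mat_ext)
  have e': "mtrunc d (transp ?B) = transp ?B" by (simp add: mtrunc_transp e)
  note b = is_pinv_trunc[OF B]
  have A: "transp (mtrunc d A) = mtrunc d A" using assms by (simp add: msym_iff_transp)
  note b' = b[THEN arg_cong[of _ _ transp], unfolded transp_mmul transp_transp A mmul_assoc]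
  show "is_pinv d A (transp ?B)"
    unfolding is_pinv_def mtrunc_eq_iff[symmetric] msym_iff_transp mtrunc_mmul e' transp_mmul transp_transp A mmul_assoc
    using e(2) b b' by (auto simp: mat_ext_def transp_def[of ?B] A)
qed

lemma psd_mtrunc: "psd d (mtrunc d A) \<longleftrightarrow> psd d A"
proof -
  have "bform d (mtrunc d A) x x = bform d A x x" for x
    by (rule bform_cong) (auto simp: mtrunc_def)
  moreover have "msym d (mtrunc d A) = msym d A" by (auto simp: msym_def mtrunc_def)
  ultimately show ?thesis by (simp add: psd_bform)
qed

lemma psd_pinv:
  assumes "psd d A"
  shows "psd d (pinv d A)"
proof -
  let ?B = "pinv d A"
  have sym: "msym d A" using assms by (simp add: psd_def)
  have B: "is_pinv d A ?B" by (rule is_pinv_pinv[OF sym])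
  have "mmul d (transp ?B) (mmul d (mtrunc d A) ?B) = ?B"
    using is_pinv_trunc(2)[OF B] by (simp add: msym_pinv[OF sym])
  then have "bform d ?B x x = bform d (mtrunc d A) (mv d ?B x) (mv d ?B x)" for x
    by (simp add: bform_mv)
  moreover have "psd d (mtrunc d A)" using assms by (simp add: psd_mtrunc)
  moreover have "msym d ?B" using msym_pinv[OF sym]
    unfolding msym_def transp_def fun_eq_iff by metis
  ultimately show ?thesis by (simp add: psd_bform)
qed

definition is_msqrt :: "nat \<Rightarrow> (nat \<Rightarrow> nat \<Rightarrow> real) \<Rightarrow> (nat \<Rightarrow> nat \<Rightarrow> real) \<Rightarrow> bool" where
  "is_msqrt d A B \<longleftrightarrow> mat_ext d B \<and> psd d B \<and> (\<forall>i<d. \<forall>j<d. mmul d B B i j = A i j)"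

text \<open>If \<open>B\<^sup>2 = C\<^sup>2\<close> then \<open>B D + D C = 0\<close> for \<open>D = B - C\<close>; testing on a unit eigenvector \<open>v\<close> of \<open>D\<close>
  with eigenvalue \<open>\<lambda>\<close> gives \<open>\<lambda> (v\<^sup>T B v + v\<^sup>T C v) = 0\<close>, whereas \<open>\<lambda> = v\<^sup>T B v - v\<^sup>T C v\<close>.\<close>

lemma is_msqrt_unique:
  assumes "is_msqrt d A B" "is_msqrt d A C"
  shows "B = C"
proof -
  define D where "D = (\<lambda>i j. B i j - C i j)"
  have eB: "mat_ext d B" and eC: "mat_ext d C" and pB: "psd d B" and pC: "psd d C"
    using assms by (auto simp: is_msqrt_def)
  have symD: "msym d D" using pB pC by (auto simp: msym_def D_def psd_def)
  obtain u l where orth: "\<And>i j. i < d \<Longrightarrow> j < d \<Longrightarrow> dotp d (u i) (u j) = idm i j"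
    and eig: "\<And>i a. i < d \<Longrightarrow> a < d \<Longrightarrow> mv d D (u i) a = l i * u i a"
    and D: "mtrunc d D = spec_mat d u l"
    using spectral_decomposition_spec_mat[OF symD] by blast
  have mvD: "mv d D x = (\<lambda>i. mv d B x i - mv d C x i)" for x
    by (auto simp: mv_def D_def left_diff_distrib sum_subtractf)
  have "l i = 0" if i: "i < d" for i
  proof -
    define b c where "b = bform d B (u i) (u i)" and "c = bform d C (u i) (u i)"
    have bc: "b \<ge> 0" "c \<ge> 0" using pB pC by (auto simp: b_def c_def psd_bform)
    have Dv: "bform d D x (u i) = l i * dotp d x (u i)" for x
    proof -
      have "bform d D x (u i) = dotp d x (\<lambda>a. l i * u i a)" unfolding bform_def
        by (rule dotp_cong) (simp_all add: eig i)
      then show ?thesis by (simp add: dotp_scale_right)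
    qed
    have 1: "b - c = l i"
      using Dv[of "u i"] orth[OF i i] unfolding b_def c_def bform_def mvD
      by (simp add: dotp_diff_right idm_def)
    have BC: "bform d (mmul d B B) (u i) (u i) = bform d (mmul d C C) (u i) (u i)"
      by (rule bform_cong) (use assms in \<open>auto simp: is_msqrt_def\<close>)
    have s: "mv d (transp B) x a = mv d B x a" if "a < d" for a x
      using pB that by (intro mv_cong) (auto simp: psd_def msym_def transp_def)
    have "0 = bform d B (u i) (mv d B (u i)) - bform d C (u i) (mv d C (u i))"
      using BC by (simp add: bform_def mv_mmul)
    also have "bform d B (u i) (mv d B (u i)) = bform d B (u i) (mv d C (u i)) + bform d B (u i) (mv d D (u i))"
      using bform_linear_right[of d B "u i" 1 "mv d C (u i)" 1 "mv d D (u i)"] by (simp add: mvD)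
    also have "bform d B (u i) (mv d D (u i)) = l i * b"
    proof -
      have "bform d B (u i) (mv d D (u i)) = bform d B (u i) (\<lambda>a. l i * u i a + 0 * u i a)"
        by (rule bform_cong) (auto simp: eig i)
      then show ?thesis unfolding bform_linear_right b_def by simp
    qed
    also have "bform d B (u i) (mv d C (u i)) = bform d C (u i) (mv d C (u i)) + l i * c"
    proof -
      have "bform d D (u i) (mv d C (u i)) = l i * c"
        using Dv[of "mv d C (u i)"] bform_commute[OF symD, of "u i" "mv d C (u i)"]
        by (simp add: c_def bform_def dotp_commute)
      then show ?thesis by (simp add: bform_def mvD dotp_diff_right)
    qed
    finally have "l i * (b + c) = 0" by (simp add: algebra_simps)
    then show ?thesis using 1 bc by auto
  qed
  then have "mtrunc d D = (\<lambda>i j. 0)" unfolding D spec_mat_def by (auto simp: mtrunc_def)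
  moreover have "mtrunc d D = D" using eB eC by (intro mtrunc_mat_ext) (auto simp: mat_ext_def D_def)
  ultimately have "D = (\<lambda>i j. 0)" by simp
  then show ?thesis by (auto simp: D_def fun_eq_iff)
qed

lemma is_msqrt_msqrt:
  assumes "psd d A"
  shows "is_msqrt d A (msqrt d A)"
proof -
  have sym: "msym d A" using assms by (simp add: psd_def)
  obtain u l where orth: "\<And>i j. i < d \<Longrightarrow> j < d \<Longrightarrow> dotp d (u i) (u j) = idm i j"
    and eig: "\<And>i a. i < d \<Longrightarrow> a < d \<Longrightarrow> mv d A (u i) a = l i * u i a"
    and A: "mtrunc d A = spec_mat d u l"
    using spectral_decomposition_spec_mat[OF sym] by blast
  have l: "0 \<le> l i" if "i < d" for i
  proof -
    have "0 \<le> bform d A (u i) (u i)" using assms by (simp add: psd_bform)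
    also have "\<dots> = dotp d (u i) (\<lambda>a. l i * u i a)" unfolding bform_def
      by (rule dotp_cong) (simp_all add: eig that)
    also have "\<dots> = l i" by (simp add: dotp_scale_right orth that idm_def)
    finally show ?thesis .
  qed
  define B where "B = spec_mat d u (\<lambda>i. sqrt (l i))"
  have "mmul d B B = spec_mat d u (\<lambda>i. sqrt (l i) * sqrt (l i))"
    unfolding B_def by (intro mmul_spec_mat orth)
  also have "\<dots> = spec_mat d u l"
    unfolding spec_mat_def using l
    by (intro arg_cong[of _ _ "mtrunc d"] ext sum.cong refl) auto
  finally have "mtrunc d (mmul d B B) = mtrunc d A"
    using A by (simp add: mtrunc_mat_ext mat_ext_spec_mat)
  then have "is_msqrt d A B"
    unfolding is_msqrt_def mtrunc_eq_iff[symmetric] using l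
    by (auto simp: B_def mat_ext_spec_mat intro!: psd_spec_mat)
  then have "is_msqrt d A (THE B. is_msqrt d A B)"
    by (rule theI[of "is_msqrt d A"]) (rule is_msqrt_unique[OF _ \<open>is_msqrt d A B\<close>])
  then show ?thesis unfolding msqrt_def is_msqrt_def[symmetric] .
qed

lemma transp_eq_self: "mat_ext d A \<Longrightarrow> msym d A \<Longrightarrow> transp A = A"
  using msym_iff_transp[of d A] by (simp add: mtrunc_mat_ext)

lemma transp_msqrt: "psd d A \<Longrightarrow> transp (msqrt d A) = msqrt d A"
  using is_msqrt_msqrt[of d A] by (auto simp: is_msqrt_def psd_def intro!: transp_eq_self)

lemma mmul_msqrt: "psd d A \<Longrightarrow> mmul d (msqrt d A) (msqrt d A) = mtrunc d A"
  using is_msqrt_msqrt[of d A]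
  by (metis is_msqrt_def mtrunc_eq_iff mtrunc_mat_ext mtrunc_mmul)

lemma bform_mtrunc: "bform d (mtrunc d A) x y = bform d A x y"
  by (rule bform_cong) (auto simp: mtrunc_def)

lemma mv_mtrunc: "i < d \<Longrightarrow> mv d (mtrunc d A) x i = mv d A x i"
  by (rule mv_cong) (auto simp: mtrunc_def)

lemma bform_eq_dotp_msqrt:
  assumes "psd d A"
  shows "bform d A x y = dotp d (mv d (msqrt d A) x) (mv d (msqrt d A) y)"
proof -
  have "bform d A x y = bform d (mmul d (msqrt d A) (msqrt d A)) x y"
    by (simp add: mmul_msqrt[OF assms] bform_mtrunc)
  also have "\<dots> = dotp d (mv d (msqrt d A) x) (mv d (msqrt d A) y)"
    by (simp add: bform_def mv_mmul dotp_mv transp_msqrt[OF assms])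
  finally show ?thesis .
qed

lemma psd_null:
  assumes "psd d A" "bform d A x x = 0" "a < d"
  shows "mv d A x a = 0"
proof -
  have "\<forall>i<d. mv d (msqrt d A) x i = 0"
    using assms(2) by (simp add: bform_eq_dotp_msqrt[OF assms(1)] dotp_self_eq_0_iff)
  then have "mv d (msqrt d A) (mv d (msqrt d A) x) a = 0" by (simp add: mv_def[of d _ "mv d _ _"])
  then show ?thesis using assms(3) by (simp add: mv_mmul[symmetric] mmul_msqrt[OF assms(1)] mv_mtrunc)
qed

definition definite :: "nat \<Rightarrow> (nat \<Rightarrow> nat \<Rightarrow> real) \<Rightarrow> bool" where
  "definite d A \<longleftrightarrow> (\<forall>x. bform d A x x = 0 \<longrightarrow> (\<forall>a<d. x a = 0))"

lemma minvertible_psd_definite: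
  assumes "psd d A" "minvertible d A"
  shows "definite d A"
  unfolding definite_def
proof (intro allI impI)
  fix x a assume x: "bform d A x x = 0" and a: "a < d"
  obtain B where B: "\<And>i j. i < d \<Longrightarrow> j < d \<Longrightarrow> mmul d B A i j = idm i j"
    using assms(2) by (auto simp: minvertible_def)
  have "x a = mv d idm x a" using a by (simp add: mv_idm)
  also have "\<dots> = mv d (mmul d B A) x a" using B a by (intro mv_cong) auto
  also have "\<dots> = 0" using psd_null[OF assms(1) x] by (simp add: mv_mmul mv_def[of d _ "mv d _ _"])
  finally show "x a = 0" .
qed

lemma mv_pinv_commute:
  assumes "msym d A" "a < d"
  shows "mv d A (mv d (pinv d A) x) a = mv d (pinv d A) (mv d A x) a"
proof -
  let ?G = "pinv d A" and ?A = "mtrunc d A"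
  have "mmul d ?A ?G = mmul d ?G ?A"
    using is_pinv_trunc(3)[OF is_pinv_pinv[OF assms(1)]] assms(1)
    by (simp add: msym_pinv msym_iff_transp)
  then have "mv d ?A (mv d ?G x) a = mv d ?G (mv d ?A x) a" by (metis mv_mmul)
  moreover have "mv d ?G (mv d ?A x) a = mv d ?G (mv d A x) a"
    by (rule mv_cong) (auto simp: mv_mtrunc)
  ultimately show ?thesis using assms(2) by (simp add: mv_mtrunc)
qed

lemma mv_mv_pinv_mv:
  assumes "msym d A" "a < d"
  shows "mv d A (mv d (pinv d A) (mv d A x)) a = mv d A x a"
proof -
  let ?G = "pinv d A"
  have "mv d A x a = mv d (mmul d (mmul d A ?G) A) x a"
    using is_pinv_pinv[OF assms(1)] assms(2) by (intro mv_cong) (auto simp: is_pinv_def)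
  then show ?thesis by (simp add: mv_mmul)
qed

lemma
  assumes sym: "msym d A" and pd: "definite d A" and "a < d"
  shows mv_pinv_mv_definite: "mv d (pinv d A) (mv d A x) a = x a"
    and mv_mv_pinv_definite: "mv d A (mv d (pinv d A) x) a = x a"
proof -
  let ?G = "pinv d A"
  define y where "y = (\<lambda>i. 1 * mv d ?G (mv d A x) i + (-1) * x i)"
  have "mv d A y i = 0" if "i < d" for i
    unfolding y_def mv_linear using mv_mv_pinv_mv[OF sym that, of x] by simp
  then have "bform d A y y = 0" by (simp add: bform_def dotp_def)
  then have "y a = 0" using pd \<open>a < d\<close> unfolding definite_def by blast
  then show 1: "mv d ?G (mv d A x) a = x a" by (simp add: y_def)
  then show "mv d A (mv d ?G x) a = x a" by (simp add: mv_pinv_commute[OF sym \<open>a < d\<close>])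
qed

text \<open>\<open>x\<^sup>T B\<^sup>-\<^sup>1 x = max\<^sub>y (2 x\<^sup>T y - y\<^sup>T B y)\<close> reverses the order.\<close>

lemma bform_inverse_antimono:
  assumes A: "psd d A" and c: "0 < c" and le: "\<And>x. c * bform d A x x \<le> bform d B x x"
    and G: "\<And>x a. a < d \<Longrightarrow> mv d A (mv d G x) a = x a"
    and H: "\<And>x a. a < d \<Longrightarrow> mv d B (mv d H x) a = x a"
  shows "bform d H x x \<le> bform d G x x / c"
proof -
  define y g where "y = mv d H x" and "g = mv d G x"
  have By: "bform d B y y = dotp d x y"
    unfolding bform_def y_def dotp_commute[of d x] by (intro dotp_cong H refl)
  have Ag: "bform d A z g = dotp d z x" for z
    unfolding bform_def g_def by (intro dotp_cong G refl)
  have sym: "msym d A" using A by (simp add: psd_def)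
  have "0 \<le> bform d A (\<lambda>i. c * y i + (-1) * g i) (\<lambda>i. c * y i + (-1) * g i)"
    using A by (simp add: psd_bform)
  also have "\<dots> = c\<^sup>2 * bform d A y y - 2 * c * dotp d y x + dotp d g x"
    unfolding bform_lincomb_self[OF sym] Ag by simp
  also have "\<dots> = c * (c * bform d A y y) - 2 * c * dotp d x y + dotp d x g"
    by (simp add: power2_eq_square dotp_commute)
  also have "\<dots> \<le> c * bform d B y y - 2 * c * dotp d x y + dotp d x g"
    using c le[of y] by simp
  finally have "c * dotp d x y \<le> dotp d x g" by (simp add: By)
  then show ?thesis using c by (simp add: bform_def y_def g_def field_simps)
qed

lemma trace_eq_sum_bform_outer:
  assumes "psd d G"
  shows "mtrace d (mmul d (mmul d (mmul d C G) (transp C)) S)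
    = (\<Sum>k<d. bform d S (\<lambda>i. mmul d C (msqrt d G) i k) (\<lambda>i. mmul d C (msqrt d G) i k))"
proof -
  let ?Q = "msqrt d G"
  have "G i j = mmul d ?Q ?Q i j" if "i < d" "j < d" for i j
    using that by (simp add: mmul_msqrt[OF assms] mtrunc_def)
  then have "mtrace d (mmul d (mmul d (mmul d C G) (transp C)) S)
      = mtrace d (mmul d (mmul d (mmul d C (mmul d ?Q ?Q)) (transp C)) S)"
    unfolding mtrace_def by (intro sum.cong refl mmul_cong) auto
  also have "\<dots> = mtrace d (mmul d (mmul d C ?Q) (mmul d (transp (mmul d C ?Q)) S))"
    by (simp add: mmul_assoc transp_mmul transp_msqrt[OF assms])
  also have "\<dots> = mtrace d (mmul d (transp (mmul d C ?Q)) (mmul d S (mmul d C ?Q)))"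
    by (subst mtrace_mmul_commute) (simp add: mmul_assoc)
  also have "\<dots> = (\<Sum>k<d. bform d S (\<lambda>i. mmul d C ?Q i k) (\<lambda>i. mmul d C ?Q i k))"
    by (rule mtrace_congruence)
  finally show ?thesis .
qed

lemma trace_eq_sum_bform_inner:
  assumes "psd d S"
  shows "mtrace d (mmul d (mmul d (mmul d C G) (transp C)) S)
    = (\<Sum>k<d. bform d G (\<lambda>i. mmul d (transp C) (msqrt d S) i k) (\<lambda>i. mmul d (transp C) (msqrt d S) i k))"
proof -
  have "mtrace d (mmul d (mmul d (mmul d C G) (transp C)) S)
      = mtrace d (mmul d (mmul d (mmul d (transp C) S) (transp (transp C))) G)"
  proof -
    have "mtrace d (mmul d (mmul d (mmul d C G) (transp C)) S) = mtrace d (mmul d (mmul d C G) (mmul d (transp C) S))"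
      by (simp add: mmul_assoc)
    also have "\<dots> = mtrace d (mmul d (mmul d (transp C) S) (mmul d C G))" by (rule mtrace_mmul_commute)
    finally show ?thesis by (simp add: mmul_assoc)
  qed
  then show ?thesis unfolding trace_eq_sum_bform_outer[OF assms] .
qed

lemma trace_mono_outer:
  assumes "psd d G" "\<And>x. bform d S x x \<le> c * bform d S' x x"
  shows "mtrace d (mmul d (mmul d (mmul d C G) (transp C)) S)
    \<le> c * mtrace d (mmul d (mmul d (mmul d C G) (transp C)) S')"
  unfolding trace_eq_sum_bform_outer[OF assms(1)] sum_distrib_left by (intro sum_mono assms)

lemma trace_mono_inner:
  assumes "psd d S" "\<And>x. bform d G x x \<le> c * bform d G' x x"
  shows "mtrace d (mmul d (mmul d (mmul d C G) (transp C)) S)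
    \<le> c * mtrace d (mmul d (mmul d (mmul d C G') (transp C)) S)"
  unfolding trace_eq_sum_bform_inner[OF assms(1)] sum_distrib_left by (intro sum_mono assms)

lemma trace_nonneg:
  assumes "psd d S" "psd d G"
  shows "0 \<le> mtrace d (mmul d (mmul d (mmul d C G) (transp C)) S)"
  unfolding trace_eq_sum_bform_outer[OF assms(2)] using assms(1) by (intro sum_nonneg) (simp add: psd_bform)

section \<open>A net of the unit sphere\<close>

definition grid :: "nat \<Rightarrow> (nat \<Rightarrow> int) set" where
  "grid d = {z \<in> PiE {..<d} (\<lambda>_. {-int (5 * d)..int (5 * d)}). (\<Sum>i<d. (z i)\<^sup>2) \<le> 25 * int d}"

definition grid_point :: "nat \<Rightarrow> (nat \<Rightarrow> int) \<Rightarrow> nat \<Rightarrow> real" where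
  "grid_point d z = (\<lambda>i. of_int (z i) / (4 * sqrt (real d)))"

lemma finite_grid: "finite (grid d)"
  unfolding grid_def by (rule finite_subset[of _ "PiE {..<d} (\<lambda>_. {-int (5 * d)..int (5 * d)})"])
    (auto intro!: finite_PiE)

lemma sum_half_power_abs_le: "(\<Sum>k\<in>{-int m..int m}. (1/2::real) ^ nat \<bar>k\<bar>) \<le> 3 - 2 * (1/2) ^ m"
proof (induction m)
  case (Suc m)
  have "{-int (Suc m)..int (Suc m)} = insert (- int (Suc m)) (insert (int (Suc m)) {-int m..int m})"
    by auto
  moreover have "nat (int m + 1) = Suc m" "nat (1 + int m) = Suc m" by auto
  ultimately have "(\<Sum>k\<in>{-int (Suc m)..int (Suc m)}. (1/2::real) ^ nat \<bar>k\<bar>)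
      = 2 * (1/2) ^ Suc m + (\<Sum>k\<in>{-int m..int m}. (1/2::real) ^ nat \<bar>k\<bar>)"
    by simp
  then show ?case using Suc.IH by simp
qed simp

lemma exp_neg_square_le: "exp (- real_of_int (k\<^sup>2)) \<le> (1/2) ^ nat \<bar>k\<bar>"
proof -
  have "\<bar>k\<bar> * 1 \<le> \<bar>k\<bar> * \<bar>k\<bar>"
  proof (cases "k = 0")
    case False
    then show ?thesis by (intro mult_left_mono) auto
  qed simp
  then have "int (nat \<bar>k\<bar>) \<le> k\<^sup>2" by (simp add: power2_eq_square)
  then have "real (nat \<bar>k\<bar>) \<le> real_of_int (k\<^sup>2)" by linarith
  then have "exp (- real_of_int (k\<^sup>2)) \<le> exp (real (nat \<bar>k\<bar>) * (-1))" by simp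
  also have "\<dots> = exp (-1) ^ nat \<bar>k\<bar>" by (rule exp_of_nat_mult)
  also have "\<dots> \<le> (1/2) ^ nat \<bar>k\<bar>"
    using exp_ge_add_one_self[of 1] by (intro power_mono) (auto simp: exp_minus field_simps)
  finally show ?thesis .
qed

lemma card_grid: "real (card (grid d)) \<le> exp (27 * real d)"
proof -
  let ?I = "{-int (5 * d)..int (5 * d)}"
  have "real (card (grid d)) = (\<Sum>z\<in>grid d. 1)" by simp
  also have "\<dots> \<le> (\<Sum>z\<in>grid d. \<Prod>i<d. exp (25 - real_of_int ((z i)\<^sup>2)))"
  proof (rule sum_mono)
    fix z assume "z \<in> grid d"
    then have "(\<Sum>i<d. (z i)\<^sup>2) \<le> 25 * int d" by (simp add: grid_def)
    then have "real_of_int (\<Sum>i<d. (z i)\<^sup>2) \<le> real_of_int (25 * int d)" by (simp only: of_int_le_iff)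
    then have "1 \<le> exp (\<Sum>i<d. 25 - real_of_int ((z i)\<^sup>2))" by (simp add: sum_subtractf)
    then show "1 \<le> (\<Prod>i<d. exp (25 - real_of_int ((z i)\<^sup>2)))" by (simp add: exp_sum)
  qed
  also have "\<dots> \<le> (\<Sum>z\<in>PiE {..<d} (\<lambda>_. ?I). \<Prod>i<d. exp (25 - real_of_int ((z i)\<^sup>2)))"
  proof (rule sum_mono2)
    show "finite (PiE {..<d} (\<lambda>_. ?I))" by (rule finite_PiE) auto
    show "grid d \<subseteq> PiE {..<d} (\<lambda>_. ?I)" unfolding grid_def by blast
  qed (rule prod_nonneg, simp)
  also have "\<dots> = (\<Prod>i<d. \<Sum>k\<in>?I. exp (25 - real_of_int (k\<^sup>2)))"
    by (subst prod_sum_PiE) auto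
  also have "\<dots> \<le> (\<Prod>i<d. exp 27)"
  proof (rule prod_mono, intro conjI sum_nonneg)
    have "(\<Sum>k\<in>?I. exp (25 - real_of_int (k\<^sup>2))) \<le> (\<Sum>k\<in>?I. exp 25 * (1/2) ^ nat \<bar>k\<bar>)"
      using exp_neg_square_le by (intro sum_mono) (auto simp: exp_diff exp_minus field_simps)
    also have "\<dots> \<le> exp 25 * 3"
      unfolding sum_distrib_left[symmetric] using sum_half_power_abs_le[of "5 * d"]
      by (intro mult_left_mono) (auto intro: order_trans)
    also have "\<dots> \<le> exp 25 * exp 2"
      using exp_ge_add_one_self[of 2] by (intro mult_left_mono) auto
    also have "\<dots> = exp (27::real)" by (simp add: exp_add[symmetric])
    finally show "(\<Sum>k\<in>?I. exp (25 - real_of_int (k\<^sup>2))) \<le> exp (27::real)" .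
  qed auto
  also have "\<dots> = exp (27 * real d)" by (simp add: exp_of_nat_mult[symmetric] mult.commute)
  finally show ?thesis .
qed

lemma dotp_grid_point:
  "dotp d (grid_point d z) (grid_point d z) = real_of_int (\<Sum>i<d. (z i)\<^sup>2) / (16 * real d)"
proof -
  have "grid_point d z i * grid_point d z i = real_of_int ((z i)\<^sup>2) / (16 * real d)" for i
    by (simp add: grid_point_def power2_eq_square)
  then show ?thesis by (simp add: dotp_def sum_divide_distrib)
qed

lemma dotp_grid_point_le:
  assumes "1 \<le> d" "z \<in> grid d"
  shows "dotp d (grid_point d z) (grid_point d z) \<le> 2"
proof -
  have "real_of_int (\<Sum>i<d. (z i)\<^sup>2) \<le> real_of_int (25 * int d)"
    using assms(2) unfolding grid_def of_int_le_iff by simp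
  then show ?thesis using assms(1) by (simp add: dotp_grid_point field_simps)
qed

lemma grid_approx:
  assumes d: "1 \<le> d" and v: "dotp d v v = 1"
  obtains z where "z \<in> grid d"
    "dotp d (\<lambda>i. 1 * v i + (-1) * grid_point d z i) (\<lambda>i. 1 * v i + (-1) * grid_point d z i) \<le> 1 / 16"
proof -
  define z where "z = (\<lambda>i. if i < d then \<lfloor>4 * sqrt (real d) * v i\<rfloor> else undefined)"
  define x where "x = (\<lambda>i. 1 * v i + (-1) * grid_point d z i)"
  have sd: "4 * sqrt (real d) > 0" using d by simp
  have xi: "(x i)\<^sup>2 \<le> 1 / (16 * real d)" if "i < d" for i
  proof -
    have e: "x i = (4 * sqrt (real d) * v i - of_int (z i)) / (4 * sqrt (real d))"
      using sd by (simp add: x_def grid_point_def field_simps)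
    have "(4 * sqrt (real d) * v i - of_int (z i))\<^sup>2 \<le> 1\<^sup>2"
      using that by (intro power_mono) (auto simp: z_def, linarith)
    then show ?thesis unfolding e power_divide by (simp add: power_mult_distrib divide_right_mono)
  qed
  have "dotp d x x \<le> (\<Sum>i<d. 1 / (16 * real d))"
    unfolding dotp_def using xi by (intro sum_mono) (auto simp: power2_eq_square)
  also have "\<dots> = 1 / 16" using d by simp
  finally have xx: "dotp d x x \<le> 1 / 16" .
  have w: "grid_point d z = (\<lambda>i. 1 * v i + (-1) * x i)" by (auto simp: x_def)
  have ww: "dotp d (grid_point d z) (grid_point d z) \<le> 25 / 16"
    using dotp_nonneg[of d "\<lambda>i. (1/2) * v i + 2 * x i"] xx v
    unfolding w dotp_lincomb_self by (simp add: power2_eq_square)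
  then have "real_of_int (\<Sum>i<d. (z i)\<^sup>2) \<le> real_of_int (25 * int d)"
    using d by (simp add: dotp_grid_point field_simps)
  then have z2: "(\<Sum>i<d. (z i)\<^sup>2) \<le> 25 * int d" by (simp only: of_int_le_iff)
  have "z i \<in> {-int (5 * d)..int (5 * d)}" if "i < d" for i
  proof -
    have "(z i)\<^sup>2 \<le> (\<Sum>i<d. (z i)\<^sup>2)" using that by (intro member_le_sum) auto
    also have "\<dots> \<le> 25 * int d" by (rule z2)
    also have "\<dots> \<le> 25 * (int d * int d)" using d by simp
    also have "\<dots> = (int (5 * d))\<^sup>2" by (simp add: power2_eq_square)
    finally have "\<bar>z i\<bar> \<le> \<bar>int (5 * d)\<bar>" by (simp only: abs_le_square_iff)
    then show ?thesis by auto
  qed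
  then have "z \<in> grid d" using z2 by (auto simp: grid_def z_def PiE_def extensional_def)
  then show thesis using xx unfolding x_def by (rule that)
qed

lemma bform_le_of_grid:
  assumes d: "1 \<le> d" and sym: "msym d M"
    and net: "\<And>z. z \<in> grid d \<Longrightarrow> \<bar>bform d M (grid_point d z) (grid_point d z)\<bar> \<le> m"
  shows "\<bar>bform d M v v\<bar> \<le> 3 * m * dotp d v v"
proof -
  define S where "S = {v. dotp d v v = 1}"
  define B where "B = (SUP v\<in>S. \<bar>bform d M v v\<bar>)"
  have ne: "S \<noteq> {}"
  proof -
    have "dotp d (\<lambda>i. if i = 0 then 1 else 0) (\<lambda>i. if i = 0 then 1 else 0) = (1::real)"
      using d unfolding dotp_def by (simp add: if_distrib[of "\<lambda>x. x * _"] sum.delta cong: if_cong)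
    then show ?thesis by (auto simp: S_def)
  qed
  have "bdd_above ((\<lambda>v. \<bar>bform d M v v\<bar>) ` S)"
  proof (rule bdd_aboveI2)
    fix v assume "v \<in> S"
    then have "(\<Sum>i<d. (v i)\<^sup>2) = 1" by (simp add: S_def dotp_def power2_eq_square)
    then have vi: "\<bar>v i\<bar> \<le> 1" if "i < d" for i
      using member_le_sum[of i "{..<d}" "\<lambda>i. (v i)\<^sup>2"] that by (simp add: abs_square_le_1)
    show "\<bar>bform d M v v\<bar> \<le> (\<Sum>i<d. \<Sum>j<d. 1 * \<bar>M i j\<bar> * 1)"
      unfolding bform_altdef
      by (intro order_trans[OF sum_abs] sum_mono, unfold abs_mult) (intro mult_mono vi, auto)
  qed
  then have B1: "\<bar>bform d M v v\<bar> \<le> B" if "v \<in> S" for v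
    unfolding B_def using that by (intro cSUP_upper)
  have B: "\<bar>bform d M v v\<bar> \<le> B * dotp d v v" for v
  proof (cases "dotp d v v = 0")
    case True
    then have "\<forall>i<d. v i = 0" by (simp add: dotp_self_eq_0_iff)
    then have "bform d M v v = 0" by (auto simp: bform_altdef)
    then show ?thesis using True by simp
  next
    case False
    then have pos: "dotp d v v > 0" using dotp_nonneg[of d v] by simp
    define s where "s = 1 / sqrt (dotp d v v)"
    have s2: "s\<^sup>2 * dotp d v v = 1" "s\<^sup>2 > 0" using pos by (auto simp: s_def field_simps)
    have "(\<lambda>i. s * v i) \<in> S"
      using s2 by (simp add: S_def dotp_scale_left dotp_scale_right power2_eq_square mult.assoc)
    then have "s\<^sup>2 * \<bar>bform d M v v\<bar> \<le> B"
      using B1[of "\<lambda>i. s * v i"] by (simp add: bform_scale abs_mult)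
    also have "B = s\<^sup>2 * (B * dotp d v v)" using s2 by (simp add: mult_ac)
    finally show ?thesis using s2(2) by simp
  qed
  have "B \<ge> 0" using ne B1 by (metis abs_ge_zero ex_in_conv order_trans)
  have "\<bar>bform d M v v\<bar> \<le> m + 9 / 16 * B" if "v \<in> S" for v
  proof -
    have vv: "dotp d v v = 1" using that by (simp add: S_def)
    obtain z where z: "z \<in> grid d" and
      xx: "dotp d (\<lambda>i. 1 * v i + (-1) * grid_point d z i) (\<lambda>i. 1 * v i + (-1) * grid_point d z i) \<le> 1 / 16"
      by (rule grid_approx[OF d vv])
    define w where "w = grid_point d z"
    define x where "x = (\<lambda>i. 1 * v i + (-1) * w i)"
    define y where "y = (\<lambda>i. 1 * v i + 1 * w i)"
    have xx: "dotp d x x \<le> 1 / 16" using xx by (simp add: x_def w_def)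
    have y: "y = (\<lambda>i. 2 * v i + (-1) * x i)" by (auto simp: y_def x_def)
    have yy: "dotp d y y \<le> 81 / 16"
      using dotp_nonneg[of d "\<lambda>i. (1/2) * v i + 2 * x i"] xx vv
      unfolding y dotp_lincomb_self by (simp add: power2_eq_square)
    have xy: "bform d M v v - bform d M w w = bform d M x y"
      unfolding x_def y_def bform_linear_left bform_linear_right using bform_commute[OF sym, of v w] by simp
    let ?p = "\<lambda>i. 3 * x i + 1/3 * y i" and ?q = "\<lambda>i. 3 * x i + (-1/3) * y i"
    have "4 * bform d M x y = bform d M ?p ?p - bform d M ?q ?q"
      unfolding bform_lincomb_self[OF sym] by (simp add: power2_eq_square)
    then have "4 * \<bar>bform d M x y\<bar> \<le> B * dotp d ?p ?p + B * dotp d ?q ?q"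
      using B[of ?p] B[of ?q] by linarith
    also have "\<dots> = B * (18 * dotp d x x + 2 / 9 * dotp d y y)"
      unfolding dotp_lincomb_self by (simp add: power2_eq_square algebra_simps)
    also have "\<dots> \<le> B * (9 / 4)" using xx yy \<open>B \<ge> 0\<close> by (intro mult_left_mono) auto
    finally have "\<bar>bform d M x y\<bar> \<le> 9 / 16 * B" by simp
    moreover have "\<bar>bform d M w w\<bar> \<le> m" unfolding w_def by (rule net[OF z])
    ultimately show ?thesis using xy by linarith
  qed
  then have "B \<le> m + 9 / 16 * B" unfolding B_def by (intro cSUP_least ne) auto
  then have "B \<le> 3 * m" using \<open>B \<ge> 0\<close> by linarith
  then have "B * dotp d v v \<le> 3 * m * dotp d v v" by (intro mult_right_mono dotp_nonneg)
  then show ?thesis using B[of v] by linarith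
qed

section \<open>Chernoff bounds\<close>

lemma exp_le_quadratic: "exp x \<le> 1 + x + x\<^sup>2 / 2 * exp \<bar>x\<bar>" for x :: real
proof -
  obtain t where t: "\<bar>t\<bar> \<le> \<bar>x\<bar>" "exp x = (\<Sum>m<2. x ^ m / fact m) + exp t / fact 2 * x ^ 2"
    using Maclaurin_exp_le[of x 2] by blast
  have "exp t \<le> exp \<bar>x\<bar>" using t(1) by simp
  then have "exp t * x\<^sup>2 \<le> exp \<bar>x\<bar> * x\<^sup>2" by (intro mult_right_mono) auto
  then show ?thesis using t(2) by (simp add: numeral_2_eq_2 mult.commute)
qed

lemma exp_mult_le_of_half:
  fixes l x :: real
  assumes "0 \<le> x" "\<bar>l\<bar> \<le> 1 / 2"
  shows "exp (l * x) \<le> 1 + l * x + 4 * l\<^sup>2 * exp x"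
proof -
  have "x\<^sup>2 / 8 \<le> exp (x / 2)"
    using exp_lower_Taylor_quadratic[of "x / 2"] assms(1) by (simp add: power2_eq_square)
  moreover have "exp \<bar>l * x\<bar> \<le> exp (x / 2)"
    using mult_right_mono[OF assms(2) assms(1)] assms(1) by (simp add: abs_mult)
  ultimately have "x\<^sup>2 / 8 * exp \<bar>l * x\<bar> \<le> exp (x / 2) * exp (x / 2)"
    by (intro mult_mono) auto
  also have "\<dots> = exp x" by (simp add: exp_add[symmetric])
  finally have "4 * l\<^sup>2 * (x\<^sup>2 / 8 * exp \<bar>l * x\<bar>) \<le> 4 * l\<^sup>2 * exp x" by (intro mult_left_mono) auto
  then show ?thesis using exp_le_quadratic[of "l * x"] by (simp add: power_mult_distrib mult_ac)
qed

lemma mgf_le_of_exp_moment: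
  assumes "prob_space p" and f[measurable]: "f \<in> borel_measurable p" and nn: "\<And>x. 0 \<le> f x"
    and le: "(\<integral>\<^sup>+x. ennreal (exp (f x)) \<partial>p) \<le> 2" and l: "\<bar>l\<bar> \<le> 1 / 2"
  shows "(\<integral>\<^sup>+x. ennreal (exp (l * f x)) \<partial>p) \<le> ennreal (exp (l * (\<integral>x. f x \<partial>p) + 8 * l\<^sup>2))"
proof -
  interpret prob_space p by fact
  have e: "integrable p (\<lambda>x. exp (f x))"
    by (rule integrableI_nonneg) (use le in \<open>auto intro: le_less_trans\<close>)
  have "ennreal (\<integral>x. exp (f x) \<partial>p) \<le> ennreal 2"
    using le nn_integral_eq_integral[OF e] by simp
  then have e2: "(\<integral>x. exp (f x) \<partial>p) \<le> 2" by (subst (asm) ennreal_le_iff) auto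
  have "f x \<le> exp (f x)" for x using exp_ge_add_one_self[of "f x"] by linarith
  then have i: "integrable p f"
    by (intro Bochner_Integration.integrable_bound[OF e f]) (auto simp: nn)
  let ?h = "\<lambda>x. 1 + l * f x + 4 * l\<^sup>2 * exp (f x)"
  have h: "exp (l * f x) \<le> ?h x" for x by (rule exp_mult_le_of_half[OF nn l])
  have "(\<integral>\<^sup>+x. ennreal (exp (l * f x)) \<partial>p) \<le> (\<integral>\<^sup>+x. ennreal (?h x) \<partial>p)"
    by (intro nn_integral_mono ennreal_leI h)
  also have "\<dots> = ennreal (\<integral>x. ?h x \<partial>p)"
    using e i by (intro nn_integral_eq_integral) (auto intro: order_trans[OF exp_ge_zero h])
  also have "(\<integral>x. ?h x \<partial>p) = 1 + l * (\<integral>x. f x \<partial>p) + 4 * l\<^sup>2 * (\<integral>x. exp (f x) \<partial>p)"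
    using e i by (simp add: prob_space)
  also have "\<dots> \<le> 1 + (l * (\<integral>x. f x \<partial>p) + 8 * l\<^sup>2)"
    using mult_left_mono[OF e2, of "4 * l\<^sup>2"] by simp
  also have "\<dots> \<le> exp (l * (\<integral>x. f x \<partial>p) + 8 * l\<^sup>2)" by (rule exp_ge_add_one_self)
  finally show "(\<integral>\<^sup>+x. ennreal (exp (l * f x)) \<partial>p) \<le> ennreal (exp (l * (\<integral>x. f x \<partial>p) + 8 * l\<^sup>2))"
    by (simp add: ennreal_leI)
qed

lemma chernoff_PiM:
  assumes "prob_space p" and f[measurable]: "f \<in> borel_measurable p"
    and mgf: "(\<integral>\<^sup>+x. ennreal (exp (l * f x)) \<partial>p) \<le> ennreal (exp (l * \<mu> + 8 * l\<^sup>2))"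
  shows "measure (PiM {..<n} (\<lambda>_. p)) {X \<in> space (PiM {..<n} (\<lambda>_. p)). a \<le> l * ((\<Sum>k<n. f (X k)) - real n * \<mu>)}
    \<le> exp (8 * real n * l\<^sup>2 - a)" (is "measure ?P ?A \<le> _")
proof -
  interpret p: prob_space p by fact
  interpret product_sigma_finite "\<lambda>_::nat. p" ..
  interpret P: prob_space ?P by (intro prob_space_PiM assms(1))
  have [measurable]: "(\<lambda>X. f (X k)) \<in> borel_measurable ?P" if "k < n" for k
    by (rule measurable_compose[OF _ f], rule measurable_component_singleton) (use that in simp)
  have [measurable]: "?A \<in> sets ?P" by measurable
  have "emeasure ?P ?A = (\<integral>\<^sup>+X. indicator ?A X \<partial>?P)" by simp
  also have "\<dots> \<le> (\<integral>\<^sup>+X. ennreal (exp (- l * real n * \<mu> - a)) * (\<Prod>k<n. ennreal (exp (l * f (X k)))) \<partial>?P)"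
  proof (rule nn_integral_mono)
    fix X
    have "indicator ?A X \<le> ennreal (exp (l * ((\<Sum>k<n. f (X k)) - real n * \<mu>) - a))"
      by (auto simp: indicator_def)
    also have "l * ((\<Sum>k<n. f (X k)) - real n * \<mu>) - a = (- l * real n * \<mu> - a) + (\<Sum>k<n. l * f (X k))"
      by (simp add: algebra_simps sum_distrib_left)
    also have "ennreal (exp \<dots>) = ennreal (exp (- l * real n * \<mu> - a)) * (\<Prod>k<n. ennreal (exp (l * f (X k))))"
      unfolding exp_add by (simp add: exp_sum prod_ennreal ennreal_mult prod_nonneg)
    finally show "indicator ?A X \<le> ennreal (exp (- l * real n * \<mu> - a)) * (\<Prod>k<n. ennreal (exp (l * f (X k))))" .
  qed
  also have "\<dots> = ennreal (exp (- l * real n * \<mu> - a)) * (\<integral>\<^sup>+X. (\<Prod>k<n. ennreal (exp (l * f (X k)))) \<partial>?P)"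
    by (rule nn_integral_cmult) measurable
  also have "(\<integral>\<^sup>+X. (\<Prod>k<n. ennreal (exp (l * f (X k)))) \<partial>?P) = (\<Prod>k<n. \<integral>\<^sup>+x. ennreal (exp (l * f x)) \<partial>p)"
    by (rule product_nn_integral_prod) auto
  also have "\<dots> \<le> (\<Prod>k<n. ennreal (exp (l * \<mu> + 8 * l\<^sup>2)))" by (intro prod_mono_ennreal mgf)
  also have "\<dots> = ennreal (exp (real n * (l * \<mu> + 8 * l\<^sup>2)))"
    by (simp add: ennreal_power exp_of_nat_mult)
  also have "ennreal (exp (- l * real n * \<mu> - a)) * ennreal (exp (real n * (l * \<mu> + 8 * l\<^sup>2)))
      = ennreal (exp (8 * real n * l\<^sup>2 - a))"
    by (simp add: ennreal_mult[symmetric] exp_add[symmetric] algebra_simps)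
  finally show ?thesis by (simp add: P.emeasure_eq_measure mult_left_mono)
qed

lemma sample_mean_deviation:
  assumes p: "prob_space p" and f[measurable]: "f \<in> borel_measurable p" and nn: "\<And>x. 0 \<le> f x"
    and le: "(\<integral>\<^sup>+x. ennreal (exp (f x)) \<partial>p) \<le> 2" and n: "1 \<le> n" and t: "0 \<le> t" "t \<le> 8"
  shows "measure (PiM {..<n} (\<lambda>_. p))
      {X \<in> space (PiM {..<n} (\<lambda>_. p)). t < \<bar>(\<Sum>k<n. f (X k)) / real n - (\<integral>x. f x \<partial>p)\<bar>}
    \<le> 2 * exp (- real n * t\<^sup>2 / 32)" (is "measure ?P ?A \<le> _")
proof -
  interpret P: prob_space ?P by (intro prob_space_PiM assms(1))
  let ?B = "\<lambda>l. {X \<in> space ?P. real n * t\<^sup>2 / 16 \<le> l * ((\<Sum>k<n. f (X k)) - real n * (\<integral>x. f x \<partial>p))}"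
  have [measurable]: "(\<lambda>X. f (X k)) \<in> borel_measurable ?P" if "k < n" for k
    by (rule measurable_compose[OF _ f], rule measurable_component_singleton) (use that in simp)
  have [measurable]: "?B l \<in> sets ?P" for l by measurable
  have B: "measure ?P (?B l) \<le> exp (- real n * t\<^sup>2 / 32)" if l: "\<bar>l\<bar> = t / 16" for l
  proof -
    have "measure ?P (?B l) \<le> exp (8 * real n * l\<^sup>2 - real n * t\<^sup>2 / 16)"
      using t l by (intro chernoff_PiM mgf_le_of_exp_moment p f nn le) auto
    also have "l\<^sup>2 = (t / 16)\<^sup>2" using l by (metis power2_abs)
    finally show ?thesis by (simp add: power2_eq_square field_simps)
  qed
  have "?A \<subseteq> ?B (t / 16) \<union> ?B (- (t / 16))"
  proof
    fix X assume X: "X \<in> ?A"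
    define D where "D = (\<Sum>k<n. f (X k)) - real n * (\<integral>x. f x \<partial>p)"
    have "(\<Sum>k<n. f (X k)) / real n - (\<integral>x. f x \<partial>p) = D / real n" using n by (simp add: D_def field_simps)
    then have "t < \<bar>D\<bar> / real n" using X by simp
    then have "real n * t \<le> \<bar>D\<bar>" using n by (simp add: field_simps)
    then have "t / 16 * (real n * t) \<le> t / 16 * \<bar>D\<bar>" using t by (intro mult_left_mono) auto
    then have "real n * t\<^sup>2 / 16 \<le> t / 16 * D \<or> real n * t\<^sup>2 / 16 \<le> - (t / 16) * D"
      by (cases "D \<ge> 0") (auto simp: power2_eq_square mult_ac)
    then show "X \<in> ?B (t / 16) \<union> ?B (- (t / 16))" using X unfolding D_def by auto
  qed
  then have "measure ?P ?A \<le> measure ?P (?B (t / 16) \<union> ?B (- (t / 16)))"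
    by (intro P.finite_measure_mono) auto
  also have "\<dots> \<le> measure ?P (?B (t / 16)) + measure ?P (?B (- (t / 16)))"
    by (intro measure_Un_le) auto
  also have "\<dots> \<le> 2 * exp (- real n * t\<^sup>2 / 32)"
    using B[of "t / 16"] B[of "- (t / 16)"] t by simp
  finally show ?thesis .
qed

text \<open>Writing \<open>exp (c\<^sup>2 Y\<^sup>2 / 2)\<close> as the moment generating function of an independent standard
  normal variable at \<open>c Y\<close> turns the bound on the moment generating function of \<open>Y\<close> into one on its
  squared exponential moment.\<close>

lemma exp_square_moment_le:
  assumes "prob_space p" and Y[measurable]: "Y \<in> borel_measurable p" and \<rho>: "0 < \<rho>"
    and sub: "\<And>s. (\<integral>\<^sup>+x. ennreal (exp (s * Y x)) \<partial>p) \<le> ennreal (exp (s\<^sup>2 * \<rho>\<^sup>2))"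
  shows "(\<integral>\<^sup>+x. ennreal (exp ((Y x)\<^sup>2 / (8 * \<rho>\<^sup>2))) \<partial>p) \<le> 2"
proof -
  interpret prob_space p by fact
  interpret pair_sigma_finite p lborel ..
  have int_nd: "(\<integral>\<^sup>+g. ennreal (normal_density \<mu> \<sigma> g) \<partial>lborel) = 1" if "0 < \<sigma>" for \<mu> \<sigma>
    using prob_space.emeasure_space_1[OF prob_space_normal_density[OF that, of \<mu>]]
    by (simp add: emeasure_density)
  have 1: "ennreal (exp ((Y x)\<^sup>2 / (8 * \<rho>\<^sup>2)))
      = (\<integral>\<^sup>+g. ennreal (normal_density 0 1 g * exp (g / (2 * \<rho>) * Y x)) \<partial>lborel)" for x
  proof -
    define c where "c = Y x / (2 * \<rho>)"
    have "normal_density 0 1 g * exp (g / (2 * \<rho>) * Y x) = exp (c\<^sup>2 / 2) * normal_density c 1 g" for g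
    proof -
      have "g / (2 * \<rho>) * Y x = g * c" by (simp add: c_def)
      moreover have "- (g\<^sup>2 / 2) + g * c = c\<^sup>2 / 2 + - ((g - c)\<^sup>2 / 2)"
        by (simp add: power2_eq_square field_simps)
      ultimately show ?thesis by (simp add: normal_density_def mult_exp_exp)
    qed
    then have "(\<integral>\<^sup>+g. ennreal (normal_density 0 1 g * exp (g / (2 * \<rho>) * Y x)) \<partial>lborel)
        = (\<integral>\<^sup>+g. ennreal (exp (c\<^sup>2 / 2)) * ennreal (normal_density c 1 g) \<partial>lborel)"
      by (simp add: ennreal_mult)
    also have "\<dots> = ennreal (exp (c\<^sup>2 / 2))" by (subst nn_integral_cmult) (auto simp: int_nd)
    also have "c\<^sup>2 / 2 = (Y x)\<^sup>2 / (8 * \<rho>\<^sup>2)" by (simp add: c_def power2_eq_square)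
    finally show ?thesis ..
  qed
  have "(\<integral>\<^sup>+x. ennreal (exp ((Y x)\<^sup>2 / (8 * \<rho>\<^sup>2))) \<partial>p)
      = (\<integral>\<^sup>+x. \<integral>\<^sup>+g. ennreal (normal_density 0 1 g * exp (g / (2 * \<rho>) * Y x)) \<partial>lborel \<partial>p)"
    unfolding 1 ..
  also have "\<dots> = (\<integral>\<^sup>+g. \<integral>\<^sup>+x. ennreal (normal_density 0 1 g * exp (g / (2 * \<rho>) * Y x)) \<partial>p \<partial>lborel)"
    by (rule Fubini'[symmetric]) measurable
  also have "\<dots> \<le> (\<integral>\<^sup>+g. ennreal (sqrt 2) * ennreal (normal_density 0 (sqrt 2) g) \<partial>lborel)"
  proof (rule nn_integral_mono)
    fix g :: real
    have "(\<integral>\<^sup>+x. ennreal (normal_density 0 1 g * exp (g / (2 * \<rho>) * Y x)) \<partial>p)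
        = ennreal (normal_density 0 1 g) * (\<integral>\<^sup>+x. ennreal (exp (g / (2 * \<rho>) * Y x)) \<partial>p)"
      by (simp add: ennreal_mult nn_integral_cmult)
    also have "\<dots> \<le> ennreal (normal_density 0 1 g) * ennreal (exp ((g / (2 * \<rho>))\<^sup>2 * \<rho>\<^sup>2))"
      by (intro mult_left_mono sub) auto
    also have "\<dots> = ennreal (normal_density 0 1 g * exp (g\<^sup>2 / 4))"
      using \<rho> by (simp add: ennreal_mult power_divide power_mult_distrib)
    also have "normal_density 0 1 g * exp (g\<^sup>2 / 4) = sqrt 2 * normal_density 0 (sqrt 2) g"
      by (simp add: normal_density_def mult_exp_exp real_sqrt_mult field_simps)
    also have "ennreal \<dots> = ennreal (sqrt 2) * ennreal (normal_density 0 (sqrt 2) g)"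
      by (simp add: ennreal_mult)
    finally show "(\<integral>\<^sup>+x. ennreal (normal_density 0 1 g * exp (g / (2 * \<rho>) * Y x)) \<partial>p)
        \<le> ennreal (sqrt 2) * ennreal (normal_density 0 (sqrt 2) g)" .
  qed
  also have "\<dots> = ennreal (sqrt 2)" by (subst nn_integral_cmult) (auto simp: int_nd)
  also have "\<dots> \<le> ennreal 2" by (intro ennreal_leI) (simp add: sqrt_le_D real_le_lsqrt)
  finally show ?thesis by simp
qed

section \<open>Concentration of empirical second moments\<close>

lemma bform_diff: "bform d (\<lambda>i j. A i j - B i j) x y = bform d A x y - bform d B x y"
  unfolding bform_altdef by (simp add: algebra_simps sum_subtractf)

lemma bform_covhat: "bform d (covhat n X) a a = (\<Sum>k<n. (dotp d a (X k))\<^sup>2) / real n"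
proof -
  have "bform d (covhat n X) a a = (\<Sum>i<d. \<Sum>j<d. \<Sum>k<n. (a i * X k i) * (a j * X k j)) / real n"
    unfolding bform_altdef covhat_def sum_divide_distrib sum_distrib_left sum_distrib_right
    by (simp add: mult_ac)
  also have "(\<Sum>i<d. \<Sum>j<d. \<Sum>k<n. (a i * X k i) * (a j * X k j))
      = (\<Sum>i<d. \<Sum>k<n. \<Sum>j<d. (a i * X k i) * (a j * X k j))"
    by (intro sum.cong refl sum.swap)
  also have "\<dots> = (\<Sum>k<n. \<Sum>i<d. \<Sum>j<d. (a i * X k i) * (a j * X k j))" by (rule sum.swap)
  also have "\<dots> = (\<Sum>k<n. (dotp d a (X k))\<^sup>2)"
    unfolding dotp_def power2_eq_square sum_product by simp
  finally show ?thesis .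
qed

lemma transp_covhat: "transp (covhat n X) = covhat n X"
  by (intro ext) (simp add: transp_def covhat_def mult.commute)

lemma transp_smom: "transp (smom p) = smom p"
  by (intro ext) (simp add: transp_def smom_def mult.commute)

lemma msym_of_transp: "transp A = A \<Longrightarrow> msym d A"
  unfolding msym_def transp_def by metis

lemma psd_covhat: "psd d (covhat n X)"
  unfolding psd_bform bform_covhat
  by (auto intro!: msym_of_transp transp_covhat divide_nonneg_nonneg sum_nonneg)

lemma vec_dist_prob_space: "vec_dist d p \<Longrightarrow> prob_space p"
  by (simp add: vec_dist_def)

lemma measurable_vec_dist_component: "vec_dist d p \<Longrightarrow> i < d \<Longrightarrow> (\<lambda>x. x i) \<in> borel_measurable p"
  by (subst measurable_cong_sets[of p "PiM {..<d} (\<lambda>_. borel)" borel borel])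
    (auto simp: vec_dist_def intro!: measurable_component_singleton)

lemma measurable_dotp: "vec_dist d p \<Longrightarrow> (\<lambda>x. dotp d a x) \<in> borel_measurable p"
  unfolding dotp_def by (intro borel_measurable_sum borel_measurable_times measurable_vec_dist_component) auto

lemma
  assumes "finite_second_moments d p"
  shows integrable_dotp_mult: "integrable p (\<lambda>x. dotp d a x * dotp d b x)"
    and bform_smom: "bform d (smom p) a b = (\<integral>x. dotp d a x * dotp d b x \<partial>p)"
proof -
  have e: "dotp d a x * dotp d b x = (\<Sum>i<d. \<Sum>j<d. a i * b j * (x i * x j))" for x
    unfolding dotp_def sum_product by (simp add: mult_ac)
  have i: "integrable p (\<lambda>x. x i * x j)" if "i < d" "j < d" for i j
    using assms that by (simp add: finite_second_moments_def)
  then show "integrable p (\<lambda>x. dotp d a x * dotp d b x)"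
    unfolding e by (intro Bochner_Integration.integrable_sum integrable_mult_right) auto
  have "(\<integral>x. dotp d a x * dotp d b x \<partial>p) = (\<Sum>i<d. \<Sum>j<d. a i * b j * (\<integral>x. x i * x j \<partial>p))"
    unfolding e using i by (subst Bochner_Integration.integral_sum, force)
      (intro sum.cong refl, subst Bochner_Integration.integral_sum, auto)
  then show "bform d (smom p) a b = (\<integral>x. dotp d a x * dotp d b x \<partial>p)"
    by (simp add: bform_altdef smom_def mult_ac)
qed

lemma msym_smom: "msym d (smom p)"
  by (intro msym_of_transp transp_smom)

lemma psd_smom: "finite_second_moments d p \<Longrightarrow> psd d (smom p)"
  unfolding psd_bform bform_smom by (auto intro!: msym_smom)

definition whitener :: "nat \<Rightarrow> (nat \<Rightarrow> real) measure \<Rightarrow> nat \<Rightarrow> nat \<Rightarrow> real" where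
  "whitener d p = msqrt d (pinv d (smom p))"

definition smom_proj :: "nat \<Rightarrow> (nat \<Rightarrow> real) measure \<Rightarrow> (nat \<Rightarrow> real) \<Rightarrow> nat \<Rightarrow> real" where
  "smom_proj d p u = mv d (mmul d (pinv d (smom p)) (smom p)) u"

context
  fixes d p
  assumes vd: "vec_dist d p" and fsm: "finite_second_moments d p"
begin

interpretation prob_space p using vd by (rule vec_dist_prob_space)

lemma transp_whitener: "transp (whitener d p) = whitener d p"
  unfolding whitener_def by (intro transp_msqrt psd_pinv psd_smom fsm)

lemma dotp_whitener: "dotp d w (mv d (whitener d p) x) = dotp d (mv d (whitener d p) w) x"
  by (simp add: dotp_mv transp_whitener)

lemma mv_smom_proj: "i < d \<Longrightarrow> mv d (smom p) (smom_proj d p u) i = mv d (smom p) u i"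
  unfolding smom_proj_def mv_mmul by (intro mv_mv_pinv_mv msym_smom)

lemma bform_smom_proj: "bform d (smom p) (smom_proj d p u) (smom_proj d p u) = bform d (smom p) u u"
proof -
  have e: "bform d (smom p) x (smom_proj d p u) = bform d (smom p) x u" for x
    unfolding bform_def by (intro dotp_cong mv_smom_proj refl)
  show ?thesis by (metis e bform_commute[OF msym_smom])
qed

lemma mv_whitener_whitener_smom:
  "i < d \<Longrightarrow> mv d (whitener d p) (mv d (whitener d p) (mv d (smom p) u)) i = smom_proj d p u i"
proof -
  assume i: "i < d"
  have G: "psd d (pinv d (smom p))" by (intro psd_pinv psd_smom fsm)
  have "mv d (whitener d p) (mv d (whitener d p) y) = mv d (mtrunc d (pinv d (smom p))) y" for y
    unfolding whitener_def mv_mmul[symmetric] mmul_msqrt[OF G] ..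
  then show ?thesis using i by (simp add: smom_proj_def mv_mmul mv_mtrunc)
qed

lemma dotp_whitener_smom:
  "dotp d (mv d (whitener d p) (mv d (smom p) u)) (mv d (whitener d p) (mv d (smom p) u)) = bform d (smom p) u u"
proof -
  have "dotp d (mv d (whitener d p) (mv d (smom p) u)) (mv d (whitener d p) (mv d (smom p) u))
      = dotp d (mv d (smom p) u) (smom_proj d p u)"
    unfolding dotp_whitener[of "mv d (whitener d p) (mv d (smom p) u)"] dotp_commute[of d _ "mv d (smom p) u"]
    by (intro dotp_cong mv_whitener_whitener_smom refl)
  also have "\<dots> = bform d (smom p) u (smom_proj d p u)"
    unfolding bform_def by (simp add: dotp_mv transp_smom)
  also have "\<dots> = bform d (smom p) u u"
    unfolding bform_def by (intro dotp_cong mv_smom_proj refl)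
  finally show ?thesis .
qed

lemma AE_dotp_smom_proj: "AE x in p. \<forall>u. dotp d (smom_proj d p u) x = dotp d u x"
proof -
  let ?K = "mmul d (pinv d (smom p)) (smom p)"
  define c where "c j = (\<lambda>i. 1 * ?K i j + (-1) * idm i j)" for j
  have "AE x in p. dotp d (c j) x = 0" if j: "j < d" for j
  proof -
    have "mv d (smom p) (c j) a = 0" if "a < d" for a
    proof -
      have "mv d (smom p) (c j) a = mmul d (smom p) ?K a j - mmul d (smom p) idm a j"
        unfolding c_def mv_linear by (simp add: mv_def mmul_def)
      then show ?thesis
        using is_pinv_pinv[OF msym_smom] j that
        by (simp add: mmul_idm_right is_pinv_def mmul_assoc)
    qed
    then have "bform d (smom p) (c j) (c j) = 0" by (simp add: bform_def dotp_def)
    then have "(\<integral>x. dotp d (c j) x * dotp d (c j) x \<partial>p) = 0" by (simp add: bform_smom[OF fsm])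
    then have "AE x in p. dotp d (c j) x * dotp d (c j) x = 0"
      by (subst (asm) integral_nonneg_eq_0_iff_AE) (auto intro: integrable_dotp_mult[OF fsm])
    then show ?thesis by simp
  qed
  then have "AE x in p. \<forall>j\<in>{..<d}. dotp d (c j) x = 0" by (intro AE_finite_allI) auto
  then show ?thesis
  proof eventually_elim
    fix x assume x: "\<forall>j\<in>{..<d}. dotp d (c j) x = 0"
    have K: "mv d (transp ?K) x j = x j" if "j < d" for j
    proof -
      have "dotp d (c j) x = mv d (transp ?K) x j - mv d (transp idm) x j"
        unfolding c_def dotp_linear_left by (simp add: dotp_def mv_def transp_def)
      moreover have "transp idm = idm" by (auto simp: transp_def idm_def fun_eq_iff)
      ultimately show ?thesis using x that by (simp add: mv_idm)
    qed
    show "\<forall>u. dotp d (smom_proj d p u) x = dotp d u x"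
    proof
      fix u
      have "dotp d (smom_proj d p u) x = dotp d u (mv d (transp ?K) x)"
        unfolding smom_proj_def by (simp add: dotp_mv)
      also have "\<dots> = dotp d u x" by (intro dotp_cong refl K)
      finally show "dotp d (smom_proj d p u) x = dotp d u x" .
    qed
  qed
qed

context
  fixes \<rho>
  assumes mz: "mean_zero d p" and sg: "subgaussian d \<rho> p"
begin

lemma subgaussian_mgf:
  "(\<integral>\<^sup>+x. ennreal (exp (s * dotp d w (mv d (whitener d p) x))) \<partial>p)
    \<le> ennreal (exp (s\<^sup>2 * \<rho>\<^sup>2 * dotp d w w / 2))"
proof -
  have m: "(\<integral>x. mv d (whitener d p) x i \<partial>p) = 0" for i
    using mz unfolding mv_def mean_zero_def by (subst Bochner_Integration.integral_sum) auto
  have sub: "(\<integral>\<^sup>+x. ennreal (exp (s * dotp d v (mv d (whitener d p) x))) \<partial>p) \<le> ennreal (exp (s\<^sup>2 * \<rho>\<^sup>2 / 2))"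
    if "dotp d v v = 1" for v s
    using sg that unfolding subgaussian_def Let_def whitener_def[symmetric] m by simp
  show ?thesis
  proof (cases "dotp d w w = 0")
    case True
    then have "\<forall>i<d. w i = 0" by (simp add: dotp_self_eq_0_iff)
    then have "dotp d w y = 0" for y by (simp add: dotp_def)
    then show ?thesis by (simp add: emeasure_space_1)
  next
    case False
    then have pos: "dotp d w w > 0" using dotp_nonneg[of d w] by simp
    define c where "c = sqrt (dotp d w w)"
    have c: "c > 0" "c\<^sup>2 = dotp d w w" using pos by (auto simp: c_def)
    define v where "v = (\<lambda>i. (1 / c) * w i)"
    have v: "dotp d v v = 1" unfolding v_def dotp_scale_left dotp_scale_right
      using c pos by (simp add: power2_eq_square field_simps)
    have "dotp d w y = c * dotp d v y" for y unfolding v_def dotp_scale_left using c by simp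
    then have "(\<integral>\<^sup>+x. ennreal (exp (s * dotp d w (mv d (whitener d p) x))) \<partial>p)
        = (\<integral>\<^sup>+x. ennreal (exp ((s * c) * dotp d v (mv d (whitener d p) x))) \<partial>p)"
      by (simp add: mult.assoc)
    also have "\<dots> \<le> ennreal (exp ((s * c)\<^sup>2 * \<rho>\<^sup>2 / 2))" by (rule sub[OF v])
    also have "(s * c)\<^sup>2 * \<rho>\<^sup>2 / 2 = s\<^sup>2 * \<rho>\<^sup>2 * dotp d w w / 2"
      unfolding power_mult_distrib c(2) by (simp add: mult_ac)
    finally show ?thesis .
  qed
qed

lemma subgaussian_parameter_lower_bound:
  assumes d: "1 \<le> d" and inv: "minvertible d (smom p)"
  shows "2 / 5 \<le> \<rho>\<^sup>2"
proof -
  define e :: "nat \<Rightarrow> real" where "e = (\<lambda>i. if i = 0 then 1 else 0)"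
  have psd: "psd d (smom p)" by (rule psd_smom[OF fsm])
  have "bform d (smom p) e e \<noteq> 0"
  proof
    assume "bform d (smom p) e e = 0"
    then have "e 0 = 0" using minvertible_psd_definite[OF psd inv] d unfolding definite_def by auto
    then show False by (simp add: e_def)
  qed
  then have pos: "bform d (smom p) e e > 0" using psd by (simp add: psd_bform less_le)
  define u where "u = (\<lambda>i. (1 / sqrt (bform d (smom p) e e)) * e i)"
  have u: "bform d (smom p) u u = 1" unfolding u_def bform_scale using pos by (simp add: power_divide)
  define v where "v = mv d (whitener d p) (mv d (smom p) u)"
  have vv: "dotp d v v = 1" unfolding v_def dotp_whitener_smom by (rule u)
  define Y where "Y = (\<lambda>x. dotp d v (mv d (whitener d p) x))"
  have Y: "Y x = dotp d (smom_proj d p u) x" for x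
    unfolding Y_def dotp_whitener unfolding v_def by (intro dotp_cong mv_whitener_whitener_smom refl)
  have [measurable]: "Y \<in> borel_measurable p" unfolding Y by (rule measurable_dotp[OF vd])
  have Y2: "integrable p (\<lambda>x. Y x * Y x)" "(\<integral>x. Y x * Y x \<partial>p) = 1"
    unfolding Y using integrable_dotp_mult[OF fsm] bform_smom[OF fsm, symmetric] bform_smom_proj u by auto
  have pt: "2 + y * y / 2 \<le> exp (1 * y) + exp ((-1) * y)" for y :: real
  proof -
    have *: "2 + y * y / 2 \<le> exp y + exp (- y)" if "0 \<le> y" for y :: real
    proof -
      have "1 + y + y * y / 2 \<le> exp y"
        using exp_lower_Taylor_quadratic[OF that] by (simp add: power2_eq_square)
      then show ?thesis using exp_ge_add_one_self[of "- y"] by linarith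
    qed
    show ?thesis using *[of y] *[of "- y"] by (cases "y \<ge> 0") simp_all
  qed
  have "ennreal (5 / 2) = ennreal (\<integral>x. 2 + Y x * Y x / 2 \<partial>p)" using Y2 by (simp add: prob_space)
  also have "\<dots> = (\<integral>\<^sup>+x. ennreal (2 + Y x * Y x / 2) \<partial>p)"
    using Y2 by (intro nn_integral_eq_integral[symmetric]) auto
  also have "\<dots> \<le> (\<integral>\<^sup>+x. ennreal (exp (1 * Y x)) + ennreal (exp ((-1) * Y x)) \<partial>p)"
    by (intro nn_integral_mono) (simp add: ennreal_plus[symmetric] ennreal_leI pt[simplified] del: ennreal_plus)
  also have "\<dots> = (\<integral>\<^sup>+x. ennreal (exp (1 * Y x)) \<partial>p) + (\<integral>\<^sup>+x. ennreal (exp ((-1) * Y x)) \<partial>p)"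
    by (rule nn_integral_add) measurable
  also have "\<dots> \<le> ennreal (exp (1\<^sup>2 * \<rho>\<^sup>2 * dotp d v v / 2)) + ennreal (exp ((-1)\<^sup>2 * \<rho>\<^sup>2 * dotp d v v / 2))"
    unfolding Y_def by (intro add_mono subgaussian_mgf)
  also have "\<dots> = ennreal (2 * exp (\<rho>\<^sup>2 / 2))" by (simp add: vv ennreal_plus[symmetric] del: ennreal_plus)
  finally have "5 / 2 \<le> 2 * exp (\<rho>\<^sup>2 / 2)" by (subst (asm) ennreal_le_iff) auto
  then have "exp (- (\<rho>\<^sup>2 / 2)) \<le> 4 / 5" by (simp add: exp_minus field_simps)
  then show ?thesis using exp_ge_add_one_self[of "- (\<rho>\<^sup>2 / 2)"] by linarith
qed

theorem empirical_smom_concentration: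
  assumes d: "1 \<le> d" and n: "1 \<le> n" and \<rho>: "0 < \<rho>" and \<delta>: "0 < \<delta>" "\<delta> < 1"
    and large: "16 * (real d + ln (1 / \<delta>)) \<le> real n"
  shows "\<exists>E\<in>sets (PiM {..<n} (\<lambda>_. p)). 1 - \<delta> / 2 \<le> measure (PiM {..<n} (\<lambda>_. p)) E \<and>
    (\<forall>X\<in>E. \<forall>u. \<bar>bform d (covhat n X) u u - bform d (smom p) u u\<bar>
       \<le> 768 * sqrt (\<rho> ^ 4 * (real d + ln (1 / \<delta>)) / real n) * bform d (smom p) u u)"
proof -
  let ?P = "PiM {..<n} (\<lambda>_. p)" and ?W = "whitener d p"
  interpret P: prob_space ?P by (intro prob_space_PiM prob_space_axioms)
  define L where "L = ln (1 / \<delta>)"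
  have L: "L > 0" using \<delta> by (simp add: L_def)
  define t where "t = 32 * sqrt ((real d + L) / real n)"
  have "(real d + L) / real n \<le> (1 / 4)\<^sup>2" using large n by (simp add: L_def field_simps power2_eq_square)
  then have "sqrt ((real d + L) / real n) \<le> 1 / 4" by (rule real_le_lsqrt[rotated]) simp
  then have t: "0 \<le> t" "t \<le> 8" using L by (auto simp: t_def)
  define Y where "Y = (\<lambda>z x. dotp d (mv d ?W (grid_point d z)) x)"
  define f where "f = (\<lambda>z x. (Y z x)\<^sup>2 / (8 * \<rho>\<^sup>2))"
  have Ym: "Y z \<in> borel_measurable p" for z unfolding Y_def by (rule measurable_dotp[OF vd])
  then have fm: "f z \<in> borel_measurable p" for z unfolding f_def by measurable
  have fe: "(\<integral>\<^sup>+x. ennreal (exp (f z x)) \<partial>p) \<le> 2" if "z \<in> grid d" for z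
    unfolding f_def
  proof (rule exp_square_moment_le[OF prob_space_axioms Ym \<rho>])
    fix s
    have "(\<integral>\<^sup>+x. ennreal (exp (s * Y z x)) \<partial>p)
        \<le> ennreal (exp (s\<^sup>2 * \<rho>\<^sup>2 * dotp d (grid_point d z) (grid_point d z) / 2))"
      unfolding Y_def dotp_whitener[symmetric] by (rule subgaussian_mgf)
    also have "\<dots> \<le> ennreal (exp (s\<^sup>2 * \<rho>\<^sup>2))"
      using mult_left_mono[OF dotp_grid_point_le[OF d that], of "s\<^sup>2 * \<rho>\<^sup>2"]
      by (intro ennreal_leI) simp
    finally show "(\<integral>\<^sup>+x. ennreal (exp (s * Y z x)) \<partial>p) \<le> ennreal (exp (s\<^sup>2 * \<rho>\<^sup>2))" .
  qed
  define A where "A = (\<lambda>z. {X \<in> space ?P. t < \<bar>(\<Sum>k<n. f z (X k)) / real n - (\<integral>x. f z x \<partial>p)\<bar>})"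
  have fc[measurable]: "(\<lambda>X. f z (X k)) \<in> borel_measurable ?P" if "k < n" for k z
    by (rule measurable_compose[OF _ fm], rule measurable_component_singleton) (use that in simp)
  have Am: "A z \<in> sets ?P" for z unfolding A_def by measurable
  define B where "B = (\<Union>z\<in>grid d. A z)"
  have Bm: "B \<in> sets ?P" unfolding B_def by (intro sets.finite_UN finite_grid Am)
  have "measure ?P B \<le> (\<Sum>z\<in>grid d. measure ?P (A z))"
    unfolding B_def using Am by (intro P.finite_measure_subadditive_finite finite_grid) auto
  also have "\<dots> \<le> (\<Sum>z\<in>grid d. 2 * exp (- real n * t\<^sup>2 / 32))"
    unfolding A_def by (intro sum_mono sample_mean_deviation prob_space_axioms fm fe n t) (auto simp: f_def)
  also have "\<dots> = real (card (grid d)) * (2 * exp (- real n * t\<^sup>2 / 32))" by simp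
  also have "\<dots> \<le> exp (27 * real d) * (2 * exp (- real n * t\<^sup>2 / 32))"
    by (intro mult_right_mono card_grid) auto
  also have "- real n * t\<^sup>2 / 32 = - (32 * (real d + L))"
    using n L by (simp add: t_def power_mult_distrib)
  also have "exp (27 * real d) * (2 * exp (- (32 * (real d + L)))) = 2 * exp (- (5 * real d) - 32 * L)"
    by (simp add: mult_exp_exp)
  also have "\<dots> \<le> 2 * exp (- 2 - L)" using d L by simp
  also have "\<dots> = 2 * exp (- 2) * \<delta>"
    using \<delta> by (simp add: L_def ln_div exp_add exp_diff exp_minus field_simps)
  also have "\<dots> \<le> 2 * (1 / 4) * \<delta>"
  proof -
    have "4 \<le> exp (2::real)" using exp_lower_Taylor_quadratic[of 2] by simp
    then have "exp (-2) \<le> 1 / (4::real)" by (simp add: exp_minus field_simps)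
    then show ?thesis using \<delta> by (intro mult_right_mono mult_left_mono) auto
  qed
  finally have B: "measure ?P B \<le> \<delta> / 2" by simp
  have "AE X in ?P. \<forall>k\<in>{..<n}. \<forall>u. dotp d (smom_proj d p u) (X k) = dotp d u (X k)"
    by (intro AE_finite_allI AE_PiM_component[of "{..<n}" "\<lambda>_. p"] prob_space_axioms AE_dotp_smom_proj) auto
  then obtain N where N: "N \<in> null_sets ?P"
    "{X \<in> space ?P. \<not> (\<forall>k\<in>{..<n}. \<forall>u. dotp d (smom_proj d p u) (X k) = dotp d u (X k))} \<subseteq> N"
    by (auto elim!: AE_E simp: null_sets_def)
  define E where "E = space ?P - B - N"
  have Em: "E \<in> sets ?P" unfolding E_def using Bm N by auto
  have "measure ?P E = measure ?P (space ?P - B)"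
    unfolding E_def using N Bm by (intro measure_Diff_null_set) auto
  also have "\<dots> = 1 - measure ?P B" by (rule P.prob_compl[OF Bm])
  finally have mE: "1 - \<delta> / 2 \<le> measure ?P E" using B by simp
  have "\<bar>bform d (covhat n X) u u - bform d (smom p) u u\<bar>
       \<le> 768 * sqrt (\<rho> ^ 4 * (real d + L) / real n) * bform d (smom p) u u" if X: "X \<in> E" for X u
  proof -
    have proj: "dotp d (smom_proj d p u) (X k) = dotp d u (X k)" if "k < n" for k
      using X N(2) that by (auto simp: E_def)
    define \<Delta> where "\<Delta> = (\<lambda>i j. covhat n X i j - smom p i j)"
    define M where "M = mmul d (transp ?W) (mmul d \<Delta> ?W)"
    have "transp \<Delta> = \<Delta>"
      using transp_covhat[of n X] transp_smom[of p] unfolding \<Delta>_def transp_def fun_eq_iff by simp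
    then have "transp M = M" by (simp add: M_def transp_mmul mmul_assoc)
    then have symM: "msym d M" by (rule msym_of_transp)
    have net: "\<bar>bform d M (grid_point d z) (grid_point d z)\<bar> \<le> 8 * \<rho>\<^sup>2 * t" if z: "z \<in> grid d" for z
    proof -
      have "X \<notin> A z" "X \<in> space ?P" using X z by (auto simp: E_def B_def)
      then have "\<bar>(\<Sum>k<n. f z (X k)) / real n - (\<integral>x. f z x \<partial>p)\<bar> \<le> t" by (simp add: A_def)
      moreover have "bform d M (grid_point d z) (grid_point d z)
          = 8 * \<rho>\<^sup>2 * ((\<Sum>k<n. f z (X k)) / real n - (\<integral>x. f z x \<partial>p))"
      proof -
        have "(\<Sum>k<n. f z (X k)) / real n = (\<Sum>k<n. (Y z (X k))\<^sup>2) / real n / (8 * \<rho>\<^sup>2)"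
          unfolding f_def sum_divide_distrib by (simp add: mult_ac)
        moreover have "(\<integral>x. f z x \<partial>p) = (\<integral>x. Y z x * Y z x \<partial>p) / (8 * \<rho>\<^sup>2)"
          unfolding f_def by (simp add: power2_eq_square)
        moreover have "bform d M (grid_point d z) (grid_point d z)
            = (\<Sum>k<n. (Y z (X k))\<^sup>2) / real n - (\<integral>x. Y z x * Y z x \<partial>p)"
          unfolding M_def bform_mv[symmetric] \<Delta>_def bform_diff bform_covhat bform_smom[OF fsm] Y_def ..
        ultimately show ?thesis using \<rho> by (simp add: field_simps)
      qed
      ultimately show ?thesis using \<rho> by (simp add: abs_mult)
    qed
    define v where "v = mv d ?W (mv d (smom p) u)"
    have "\<bar>bform d M v v\<bar> \<le> 3 * (8 * \<rho>\<^sup>2 * t) * dotp d v v"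
      by (rule bform_le_of_grid[OF d symM net])
    moreover have "dotp d v v = bform d (smom p) u u" unfolding v_def by (rule dotp_whitener_smom)
    moreover have "bform d M v v = bform d (covhat n X) u u - bform d (smom p) u u"
    proof -
      have "bform d M v v = bform d \<Delta> (smom_proj d p u) (smom_proj d p u)"
        unfolding M_def bform_mv[symmetric] v_def by (intro bform_cong mv_whitener_whitener_smom refl)
      then show ?thesis unfolding \<Delta>_def bform_diff bform_smom_proj bform_covhat by (simp add: proj)
    qed
    moreover have "3 * (8 * \<rho>\<^sup>2 * t) = 768 * sqrt (\<rho> ^ 4 * (real d + L) / real n)"
    proof -
      have "sqrt (\<rho> ^ 4) = \<rho>\<^sup>2" by (rule real_sqrt_unique) auto
      then have "sqrt (\<rho> ^ 4 * ((real d + L) / real n)) = \<rho>\<^sup>2 * sqrt ((real d + L) / real n)"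
        by (simp only: real_sqrt_mult)
      then show ?thesis by (simp add: t_def)
    qed
    ultimately show ?thesis by simp
  qed
  then show ?thesis using Em mE unfolding L_def by blast
qed

end

end

section \<open>Risk of linear estimators\<close>

lemma
  assumes "0 < s"
  shows integrable_normal_self: "integrable (density lborel (normal_density 0 s)) (\<lambda>x. x)"
    and integral_normal_self: "(\<integral>x. x \<partial>density lborel (normal_density 0 s)) = 0"
    and integrable_normal_square: "integrable (density lborel (normal_density 0 s)) (\<lambda>x. x * x)"
    and integral_normal_square: "(\<integral>x. x * x \<partial>density lborel (normal_density 0 s)) = s\<^sup>2"
proof -
  have 1: "has_bochner_integral lborel (\<lambda>x. normal_density 0 s x * x) 0"
    using normal_moment_odd[OF assms, of 0 0] by simp
  have 2: "has_bochner_integral lborel (\<lambda>x. normal_density 0 s x * (x * x)) (s\<^sup>2)"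
    using normal_moment_even[OF assms, of 0 1] by (simp add: power2_eq_square)
  show "integrable (density lborel (normal_density 0 s)) (\<lambda>x. x)"
    "integrable (density lborel (normal_density 0 s)) (\<lambda>x. x * x)"
    using 1 2 by (auto simp: integrable_density has_bochner_integral_iff)
  show "(\<integral>x. x \<partial>density lborel (normal_density 0 s)) = 0"
    "(\<integral>x. x * x \<partial>density lborel (normal_density 0 s)) = s\<^sup>2"
    using 1 2 by (auto simp: integral_density has_bochner_integral_iff)
qed

lemma vec_dist_gauss: "0 < s \<Longrightarrow> vec_dist m (gauss m s)"
  unfolding vec_dist_def gauss_def
  by (auto intro!: prob_space_PiM prob_space_normal_density sets_PiM_cong)

lemma
  assumes s: "0 < s" and k: "k < m" and l: "l < m"
  shows integrable_gauss_mult: "integrable (gauss m s) (\<lambda>z. z k * z l)"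
    and integral_gauss_mult: "(\<integral>z. z k * z l \<partial>gauss m s) = s\<^sup>2 * idm k l"
proof -
  let ?N = "density lborel (normal_density 0 s)"
  interpret N: prob_space ?N by (rule prob_space_normal_density[OF s])
  interpret product_sigma_finite "\<lambda>_::nat. ?N" ..
  define h where "h = (\<lambda>i (x::real). (if i = k then x else 1) * (if i = l then x else 1))"
  have e: "z k * z l = (\<Prod>i<m. h i (z i))" for z
    unfolding h_def using k l by (simp add: prod.distrib prod.delta)
  have i: "integrable ?N (h i)" for i
    unfolding h_def using integrable_normal_self[OF s] integrable_normal_square[OF s]
    by (cases "i = k"; cases "i = l") auto
  show "integrable (gauss m s) (\<lambda>z. z k * z l)"
    unfolding gauss_def e by (rule product_integrable_prod) (auto intro: i)
  have "(\<integral>z. z k * z l \<partial>gauss m s) = (\<Prod>i<m. \<integral>x. h i x \<partial>?N)"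
    unfolding gauss_def e by (rule product_integral_prod) (auto intro: i)
  also have "\<dots> = s\<^sup>2 * idm k l"
  proof (cases "k = l")
    case True
    then have "(\<integral>x. h i x \<partial>?N) = (if i = k then s\<^sup>2 else 1)" for i
      by (simp add: h_def integral_normal_square[OF s] N.prob_space[simplified])
    then show ?thesis using k True by (simp add: idm_def prod.delta)
  next
    case False
    then have "(\<integral>x. h k x \<partial>?N) = 0" by (simp add: h_def integral_normal_self[OF s])
    then show ?thesis using k False by (auto simp: idm_def intro!: prod_zero)
  qed
  finally show "(\<integral>z. z k * z l \<partial>gauss m s) = s\<^sup>2 * idm k l" .
qed

lemma
  assumes s: "0 < s" and k: "k < m"
  shows integrable_gauss_component: "integrable (gauss m s) (\<lambda>z. z k)"
    and integral_gauss_component: "(\<integral>z. z k \<partial>gauss m s) = 0"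
proof -
  let ?N = "density lborel (normal_density 0 s)"
  interpret N: prob_space ?N by (rule prob_space_normal_density[OF s])
  interpret product_sigma_finite "\<lambda>_::nat. ?N" ..
  define h where "h = (\<lambda>i (x::real). if i = k then x else 1)"
  have e: "z k = (\<Prod>i<m. h i (z i))" for z
    unfolding h_def using k by (simp add: prod.delta)
  have i: "integrable ?N (h i)" for i
    unfolding h_def using integrable_normal_self[OF s] by (cases "i = k") auto
  show "integrable (gauss m s) (\<lambda>z. z k)"
    unfolding gauss_def e by (rule product_integrable_prod) (auto intro: i)
  have "(\<integral>z. z k \<partial>gauss m s) = (\<Prod>i<m. \<integral>x. h i x \<partial>?N)"
    unfolding gauss_def e by (rule product_integral_prod) (auto intro: i)
  also have "\<dots> = 0"
    using k integral_normal_self[OF s] by (auto simp: h_def intro!: prod_zero bexI[of _ k])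
  finally show "(\<integral>z. z k \<partial>gauss m s) = 0" .
qed

lemma linear_estimator_risk:
  assumes p: "vec_dist d p" "finite_second_moments d p" and s: "0 < s"
  shows "(\<integral>\<^sup>+z. (\<integral>\<^sup>+x. ennreal ((dotp d x (\<lambda>i. a i + mv m N z i))\<^sup>2) \<partial>p) \<partial>gauss m s)
    = ennreal (bform d (smom p) a a + s\<^sup>2 * (\<Sum>k<m. bform d (smom p) (\<lambda>i. N i k) (\<lambda>i. N i k)))"
proof -
  let ?S = "smom p" and ?g = "gauss m s"
  interpret g: prob_space ?g using vec_dist_gauss[OF s] by (rule vec_dist_prob_space)
  have sym: "msym d ?S" by (rule msym_smom)
  define K where "K = mmul d (transp N) (mmul d ?S N)"
  define c where "c = mv d (transp (mmul d ?S N)) a"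
  have inner: "(\<integral>\<^sup>+x. ennreal ((dotp d x w)\<^sup>2) \<partial>p) = ennreal (bform d ?S w w)" for w
  proof -
    have "(\<integral>\<^sup>+x. ennreal ((dotp d x w)\<^sup>2) \<partial>p) = (\<integral>\<^sup>+x. ennreal (dotp d w x * dotp d w x) \<partial>p)"
      by (simp add: power2_eq_square dotp_commute)
    also have "\<dots> = ennreal (bform d ?S w w)"
      unfolding bform_smom[OF p(2)] by (intro nn_integral_eq_integral integrable_dotp_mult p) auto
    finally show ?thesis .
  qed
  have expand: "bform d ?S (\<lambda>i. a i + mv m N z i) (\<lambda>i. a i + mv m N z i)
      = bform d ?S a a + 2 * dotp m c z + (\<Sum>k<m. \<Sum>l<m. K k l * (z k * z l))" for z
  proof -
    have "bform d ?S (\<lambda>i. 1 * a i + 1 * mv m N z i) (\<lambda>i. 1 * a i + 1 * mv m N z i)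
        = bform d ?S a a + 2 * bform d ?S a (mv m N z) + bform d ?S (mv m N z) (mv m N z)"
      unfolding bform_lincomb_self[OF sym] by simp
    moreover have "bform d ?S a (mv m N z) = dotp m c z"
      unfolding bform_def c_def by (simp add: mv_mmul[symmetric] dotp_mv)
    moreover have "bform d ?S (mv m N z) (mv m N z) = (\<Sum>k<m. \<Sum>l<m. K k l * (z k * z l))"
      unfolding bform_mv K_def[symmetric] by (simp add: bform_altdef mult_ac)
    ultimately show ?thesis by simp
  qed
  have i1: "integrable ?g (\<lambda>z. dotp m c z)" and e1: "(\<integral>z. dotp m c z \<partial>?g) = 0"
    unfolding dotp_def
    by (auto intro!: Bochner_Integration.integrable_sum integrable_mult_right integrable_gauss_component[OF s]
        simp: Bochner_Integration.integral_sum integrable_gauss_component[OF s] integral_gauss_component[OF s])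
  have i2: "integrable ?g (\<lambda>z. \<Sum>k<m. \<Sum>l<m. K k l * (z k * z l))"
    by (intro Bochner_Integration.integrable_sum integrable_mult_right integrable_gauss_mult[OF s]) auto
  have "(\<integral>z. (\<Sum>k<m. \<Sum>l<m. K k l * (z k * z l)) \<partial>?g) = (\<Sum>k<m. \<Sum>l<m. K k l * (s\<^sup>2 * idm k l))"
  proof -
    have "(\<integral>z. (\<Sum>k<m. \<Sum>l<m. K k l * (z k * z l)) \<partial>?g)
        = (\<Sum>k<m. \<integral>z. (\<Sum>l<m. K k l * (z k * z l)) \<partial>?g)"
      by (intro Bochner_Integration.integral_sum Bochner_Integration.integrable_sum
          integrable_mult_right integrable_gauss_mult[OF s]) auto
    also have "\<dots> = (\<Sum>k<m. \<Sum>l<m. \<integral>z. K k l * (z k * z l) \<partial>?g)"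
      by (intro sum.cong refl Bochner_Integration.integral_sum
          integrable_mult_right integrable_gauss_mult[OF s]) auto
    also have "\<dots> = (\<Sum>k<m. \<Sum>l<m. K k l * (s\<^sup>2 * idm k l))"
      by (intro sum.cong refl) (simp add: integral_gauss_mult[OF s])
    finally show ?thesis .
  qed
  also have "\<dots> = s\<^sup>2 * (\<Sum>k<m. K k k)"
    by (simp add: idm_def if_distrib[of "\<lambda>x. _ * x"] sum.delta sum_distrib_left mult.commute cong: if_cong)
  also have "(\<Sum>k<m. K k k) = (\<Sum>k<m. bform d ?S (\<lambda>i. N i k) (\<lambda>i. N i k))"
    unfolding K_def mmul_def transp_def bform_def dotp_def mv_def by simp
  finally have e2: "(\<integral>z. (\<Sum>k<m. \<Sum>l<m. K k l * (z k * z l)) \<partial>?g)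
      = s\<^sup>2 * (\<Sum>k<m. bform d ?S (\<lambda>i. N i k) (\<lambda>i. N i k))" .
  have nn: "0 \<le> bform d ?S w w" for w using psd_smom[OF p(2)] by (simp add: psd_bform)
  have "(\<integral>\<^sup>+z. (\<integral>\<^sup>+x. ennreal ((dotp d x (\<lambda>i. a i + mv m N z i))\<^sup>2) \<partial>p) \<partial>?g)
      = (\<integral>\<^sup>+z. ennreal (bform d ?S a a + 2 * dotp m c z + (\<Sum>k<m. \<Sum>l<m. K k l * (z k * z l))) \<partial>?g)"
    unfolding inner expand ..
  also have "\<dots> = ennreal (\<integral>z. bform d ?S a a + 2 * dotp m c z + (\<Sum>k<m. \<Sum>l<m. K k l * (z k * z l)) \<partial>?g)"
    using i1 i2 nn[of "\<lambda>i. a i + mv m N _ i", unfolded expand]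
    by (intro nn_integral_eq_integral) auto
  also have "(\<integral>z. bform d ?S a a + 2 * dotp m c z + (\<Sum>k<m. \<Sum>l<m. K k l * (z k * z l)) \<partial>?g)
      = bform d ?S a a + s\<^sup>2 * (\<Sum>k<m. bform d ?S (\<lambda>i. N i k) (\<lambda>i. N i k))"
    using i1 i2 e1 e2 by (simp add: g.prob_space)
  finally show ?thesis .
qed

lemma dotp_cong_right: "(\<And>i. i < d \<Longrightarrow> y i = z i) \<Longrightarrow> dotp d x y = dotp d x z"
  by (rule dotp_cong) auto

lemma mv_diff_idm: "i < d \<Longrightarrow> mv d (\<lambda>i j. C i j - idm i j) \<beta> i = mv d C \<beta> i - \<beta> i"
proof -
  assume "i < d"
  have "mv d (\<lambda>i j. C i j - idm i j) \<beta> i = mv d C \<beta> i - mv d idm \<beta> i"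
    by (simp add: mv_def left_diff_distrib sum_subtractf)
  then show ?thesis using \<open>i < d\<close> by (simp add: mv_idm)
qed

lemma betahat_variance:
  "(\<Sum>k<n. bform d S (\<lambda>i. mmul d (mmul d C (pinv d (covhat n X))) (\<lambda>j k. X k j / real n) i k)
        (\<lambda>i. mmul d (mmul d C (pinv d (covhat n X))) (\<lambda>j k. X k j / real n) i k))
    = mtrace d (mmul d (mmul d (mmul d C (pinv d (covhat n X))) (transp C)) S) / real n"
proof -
  let ?G = "pinv d (covhat n X)"
  define F where "F = mmul d C ?G"
  define B where "B = mmul d (transp F) (mmul d S F)"
  have sym: "msym d (covhat n X)" using psd_covhat by (simp add: psd_def)
  have "(\<Sum>k<n. bform d S (\<lambda>i. mmul d F (\<lambda>j k. X k j / real n) i k) (\<lambda>i. mmul d F (\<lambda>j k. X k j / real n) i k))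
      = (\<Sum>k<n. bform d B (\<lambda>j. X k j / real n) (\<lambda>j. X k j / real n))"
    unfolding B_def bform_mv[symmetric] by (simp add: mmul_def mv_def)
  also have "\<dots> = (\<Sum>k<n. \<Sum>i<d. \<Sum>j<d. B i j * (X k j * X k i)) / real n / real n"
    unfolding bform_altdef sum_divide_distrib by (simp add: mult_ac)
  also have "(\<Sum>k<n. \<Sum>i<d. \<Sum>j<d. B i j * (X k j * X k i)) = (\<Sum>i<d. \<Sum>k<n. \<Sum>j<d. B i j * (X k j * X k i))"
    by (rule sum.swap)
  also have "\<dots> = (\<Sum>i<d. \<Sum>j<d. \<Sum>k<n. B i j * (X k j * X k i))"
    by (intro sum.cong refl sum.swap)
  also have "\<dots> / real n = mtrace d (mmul d B (covhat n X))"
    by (simp add: mtrace_def mmul_def covhat_def sum_divide_distrib sum_distrib_left)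
  also have "\<dots> = mtrace d (mmul d B (mtrunc d (covhat n X)))"
    unfolding mtrace_def by (intro sum.cong refl mmul_cong) (auto simp: mtrunc_def)
  also have "\<dots> = mtrace d (mmul d (mmul d (transp F) S) (mmul d F (mtrunc d (covhat n X))))"
    by (simp add: B_def mmul_assoc)
  also have "\<dots> = mtrace d (mmul d (mmul d F (mtrunc d (covhat n X))) (mmul d (transp F) S))"
    by (rule mtrace_mmul_commute)
  also have "\<dots> = mtrace d (mmul d C (mmul d (mmul d ?G (mmul d (mtrunc d (covhat n X)) ?G)) (mmul d (transp C) S)))"
    by (simp add: F_def mmul_assoc transp_mmul msym_pinv[OF sym])
  also have "mmul d ?G (mmul d (mtrunc d (covhat n X)) ?G) = ?G"
    by (rule is_pinv_trunc(2)[OF is_pinv_pinv[OF sym]])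
  finally show ?thesis by (simp add: F_def mmul_assoc)
qed

lemma loss_B_betahat:
  assumes p: "vec_dist d p" "finite_second_moments d p" and \<sigma>: "0 < \<sigma>" and n: "1 \<le> n"
    and pd: "definite d (covhat n X)"
  defines "D \<equiv> \<lambda>C i j. C i j - idm i j"
  shows "loss_B d n \<sigma> r p X (betahat d n X C) = (SUP \<beta>\<in>ball_B d r.
    ennreal (bform d (smom p) (mv d (D C) \<beta>) (mv d (D C) \<beta>)
      + \<sigma>\<^sup>2 / real n * mtrace d (mmul d (mmul d (mmul d C (pinv d (covhat n X))) (transp C)) (smom p))))"
proof -
  let ?G = "pinv d (covhat n X)"
  define T where "T = (\<lambda>j k. X k j / real n)"
  define N where "N = mmul d (mmul d C ?G) T"
  have sym: "msym d (covhat n X)" using psd_covhat by (simp add: psd_def)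
  have est: "betahat d n X C (\<lambda>k. dotp d (X k) \<beta> + z k) i - \<beta> i = mv d (D C) \<beta> i + mv n N z i"
    if i: "i < d" for \<beta> z i
  proof -
    have "(\<Sum>k<n. X k j * (dotp d (X k) \<beta> + z k)) / real n = 1 * mv d (covhat n X) \<beta> j + 1 * mv n T z j" for j
    proof -
      have "(\<Sum>k<n. X k j * dotp d (X k) \<beta>) = (\<Sum>l<d. (\<Sum>k<n. X k j * X k l) * \<beta> l)"
        unfolding dotp_def sum_distrib_left sum_distrib_right by (subst sum.swap) (simp add: mult_ac)
      then have "(\<Sum>k<n. X k j * dotp d (X k) \<beta>) / real n = mv d (covhat n X) \<beta> j"
        by (simp only: mv_def covhat_def sum_divide_distrib[of _ "{..<d}"] times_divide_eq_left)
      moreover have "(\<Sum>k<n. X k j * z k) / real n = mv n T z j"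
        by (simp add: mv_def T_def sum_divide_distrib)
      ultimately show ?thesis by (simp add: distrib_left sum.distrib add_divide_distrib)
    qed
    then have "betahat d n X C (\<lambda>k. dotp d (X k) \<beta> + z k) i
        = mv d (mmul d C ?G) (\<lambda>j. 1 * mv d (covhat n X) \<beta> j + 1 * mv n T z j) i"
      by (simp add: betahat_def)
    also have "\<dots> = mv d C (mv d ?G (mv d (covhat n X) \<beta>)) i + mv n N z i"
      unfolding mv_linear by (simp add: mv_mmul N_def)
    also have "mv d C (mv d ?G (mv d (covhat n X) \<beta>)) i = mv d C \<beta> i"
      by (intro mv_cong refl mv_pinv_mv_definite sym pd)
    finally show ?thesis using i by (simp add: D_def mv_diff_idm)
  qed
  show ?thesis unfolding loss_B_def
  proof (rule SUP_cong[OF refl])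
    fix \<beta> assume "\<beta> \<in> ball_B d r"
    have "(\<integral>\<^sup>+z. (\<integral>\<^sup>+x. ennreal ((dotp d x (\<lambda>i. betahat d n X C (\<lambda>k. dotp d (X k) \<beta> + z k) i - \<beta> i))\<^sup>2) \<partial>p) \<partial>gauss n \<sigma>)
        = (\<integral>\<^sup>+z. (\<integral>\<^sup>+x. ennreal ((dotp d x (\<lambda>i. mv d (D C) \<beta> i + mv n N z i))\<^sup>2) \<partial>p) \<partial>gauss n \<sigma>)"
      by (intro nn_integral_cong arg_cong[of _ _ ennreal] arg_cong[of _ _ "\<lambda>x. x\<^sup>2"] dotp_cong_right est)
    also have "\<dots> = ennreal (bform d (smom p) (mv d (D C) \<beta>) (mv d (D C) \<beta>)
        + \<sigma>\<^sup>2 * (\<Sum>k<n. bform d (smom p) (\<lambda>i. N i k) (\<lambda>i. N i k)))"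
      by (rule linear_estimator_risk[OF p \<sigma>])
    also have "(\<Sum>k<n. bform d (smom p) (\<lambda>i. N i k) (\<lambda>i. N i k))
        = mtrace d (mmul d (mmul d (mmul d C ?G) (transp C)) (smom p)) / real n"
      unfolding N_def T_def by (rule betahat_variance)
    finally show "(\<integral>\<^sup>+z. (\<integral>\<^sup>+x. ennreal ((dotp d x (\<lambda>i. betahat d n X C (\<lambda>k. dotp d (X k) \<beta> + z k) i - \<beta> i))\<^sup>2) \<partial>p) \<partial>gauss n \<sigma>)
        = ennreal (bform d (smom p) (mv d (D C) \<beta>) (mv d (D C) \<beta>)
      + \<sigma>\<^sup>2 / real n * mtrace d (mmul d (mmul d (mmul d C ?G) (transp C)) (smom p)))"
      by simp
  qed
qed

lemma msqrt_pinv_msqrt: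
  assumes psd: "psd d S" and pd: "definite d S" and "a < d"
  shows "mv d (msqrt d S) (mv d (pinv d S) (mv d (msqrt d S) x)) a = x a"
proof -
  let ?R = "msqrt d S" and ?G = "pinv d S"
  have sym: "msym d S" using psd by (simp add: psd_def)
  have RR: "mv d ?R (mv d ?R y) i = mv d S y i" if "i < d" for y i
    using that by (simp add: mv_mmul[symmetric] mmul_msqrt[OF psd] mv_mtrunc)
  define y where "y = (\<lambda>i. 1 * mv d ?R (mv d ?G (mv d ?R x)) i + (-1) * x i)"
  have "mv d ?R y i = 0" if "i < d" for i
    using RR[OF that, of "mv d ?G (mv d ?R x)"] mv_mv_pinv_definite[OF sym pd that, of "mv d ?R x"]
    unfolding y_def mv_linear by simp
  then have "bform d S y y = 0" unfolding bform_eq_dotp_msqrt[OF psd] by (simp add: dotp_def)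
  then have "y a = 0" using pd \<open>a < d\<close> unfolding definite_def by blast
  then show ?thesis by (simp add: y_def)
qed

lemma loss_R_linear:
  fixes A
  assumes p: "vec_dist d p" "finite_second_moments d p" and \<sigma>: "0 < \<sigma>" and n: "1 \<le> n"
    and psd: "psd d S" and pd: "definite d S"
  defines "D \<equiv> \<lambda>C i j. C i j - idm i j"
  defines "C \<equiv> mmul d A (msqrt d S)"
  shows "loss_R d n \<sigma> r p S (\<lambda>y. mv d A y) = (SUP \<beta>\<in>ball_B d r.
    ennreal (bform d (smom p) (mv d (D C) \<beta>) (mv d (D C) \<beta>)
      + \<sigma>\<^sup>2 / real n * mtrace d (mmul d (mmul d (mmul d C (pinv d S)) (transp C)) (smom p))))"
proof -
  let ?R = "msqrt d S" and ?G = "pinv d S"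
  have s: "0 < \<sigma> / sqrt (real n)" using \<sigma> n by simp
  have est: "mv d A (\<lambda>j. mv d ?R \<beta> j + z j) i - \<beta> i = mv d (D C) \<beta> i + mv d A z i" if "i < d" for \<beta> z i
    using mv_linear[of d A 1 "mv d ?R \<beta>" 1 z] that by (simp add: D_def mv_diff_idm C_def mv_mmul)
  define K where "K = mmul d ?R (mmul d ?G ?R)"
  have K: "K i j = idm i j" if "i < d" "j < d" for i j
  proof -
    have "K i j = mv d K (\<lambda>k. idm k j) i" using mmul_idm_right[of j d K i] that by (simp add: mmul_def mv_def)
    also have "\<dots> = idm i j" unfolding K_def mv_mmul by (intro msqrt_pinv_msqrt psd pd that)
    finally show ?thesis .
  qed
  have "mtrace d (mmul d (mmul d (mmul d C ?G) (transp C)) (smom p))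
      = mtrace d (mmul d A (mmul d K (mmul d (transp A) (smom p))))"
    by (simp add: C_def K_def mmul_assoc transp_mmul transp_msqrt[OF psd])
  also have "\<dots> = mtrace d (mmul d A (mmul d idm (mmul d (transp A) (smom p))))"
    unfolding mtrace_def by (intro sum.cong refl mmul_cong K) auto
  also have "\<dots> = mtrace d (mmul d A (mmul d (transp A) (smom p)))"
    unfolding mtrace_def by (intro sum.cong refl mmul_cong mmul_idm_left) auto
  also have "\<dots> = mtrace d (mmul d (transp A) (mmul d (smom p) A))"
    by (subst mtrace_mmul_commute) (simp add: mmul_assoc)
  also have "\<dots> = (\<Sum>k<d. bform d (smom p) (\<lambda>i. A i k) (\<lambda>i. A i k))" by (rule mtrace_congruence)
  finally have var: "mtrace d (mmul d (mmul d (mmul d C ?G) (transp C)) (smom p))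
      = (\<Sum>k<d. bform d (smom p) (\<lambda>i. A i k) (\<lambda>i. A i k))" .
  show ?thesis unfolding loss_R_def
  proof (rule SUP_cong[OF refl])
    fix \<beta> assume "\<beta> \<in> ball_B d r"
    have "(\<integral>\<^sup>+z. (\<integral>\<^sup>+x. ennreal ((dotp d x (\<lambda>i. mv d A (\<lambda>j. mv d ?R \<beta> j + z j) i - \<beta> i))\<^sup>2) \<partial>p) \<partial>gauss d (\<sigma> / sqrt (real n)))
        = (\<integral>\<^sup>+z. (\<integral>\<^sup>+x. ennreal ((dotp d x (\<lambda>i. mv d (D C) \<beta> i + mv d A z i))\<^sup>2) \<partial>p) \<partial>gauss d (\<sigma> / sqrt (real n)))"
      by (intro nn_integral_cong arg_cong[of _ _ ennreal] arg_cong[of _ _ "\<lambda>x. x\<^sup>2"] dotp_cong_right est)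
    also have "\<dots> = ennreal (bform d (smom p) (mv d (D C) \<beta>) (mv d (D C) \<beta>)
        + (\<sigma> / sqrt (real n))\<^sup>2 * (\<Sum>k<d. bform d (smom p) (\<lambda>i. A i k) (\<lambda>i. A i k)))"
      by (rule linear_estimator_risk[OF p s])
    also have "(\<sigma> / sqrt (real n))\<^sup>2 = \<sigma>\<^sup>2 / real n" by (simp add: power_divide)
    finally show "(\<integral>\<^sup>+z. (\<integral>\<^sup>+x. ennreal ((dotp d x (\<lambda>i. mv d A (\<lambda>j. mv d ?R \<beta> j + z j) i - \<beta> i))\<^sup>2) \<partial>p) \<partial>gauss d (\<sigma> / sqrt (real n)))
        = ennreal (bform d (smom p) (mv d (D C) \<beta>) (mv d (D C) \<beta>)
      + \<sigma>\<^sup>2 / real n * mtrace d (mmul d (mmul d (mmul d C ?G) (transp C)) (smom p)))"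
      unfolding var .
  qed
qed

section \<open>The oracle inequality\<close>

lemma sdp_feasible_iff:
  assumes "transp S = S"
  shows "sdp_feasible d S C \<tau> \<longleftrightarrow>
    (\<forall>x. bform d S (mv d (\<lambda>i j. C i j - idm i j) x) (mv d (\<lambda>i j. C i j - idm i j) x) \<le> \<tau> * dotp d x x)"
proof -
  define D where "D = (\<lambda>i j. C i j - idm i j)"
  define K where "K = mmul d (transp D) (mmul d S D)"
  have "transp K = K" by (simp add: K_def transp_mmul mmul_assoc assms)
  then have "transp (\<lambda>i j. \<tau> * idm i j - K i j) = (\<lambda>i j. \<tau> * idm i j - K i j)"
    unfolding transp_def idm_def fun_eq_iff by auto
  then have sym: "msym d (\<lambda>i j. \<tau> * idm i j - K i j)" by (rule msym_of_transp)
  have "bform d (\<lambda>i j. \<tau> * idm i j - K i j) x x = \<tau> * dotp d x x - bform d S (mv d D x) (mv d D x)" for x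
  proof -
    have "mv d (\<lambda>i j. \<tau> * idm i j) x i = \<tau> * x i" if "i < d" for i
      using mv_idm[OF that, of x] by (simp add: mv_def mult.assoc sum_distrib_left[symmetric])
    then have "bform d (\<lambda>i j. \<tau> * idm i j) x x = dotp d x (\<lambda>i. \<tau> * x i)"
      unfolding bform_def by (intro dotp_cong_right)
    then show ?thesis unfolding bform_diff K_def bform_mv by (simp add: dotp_scale_right)
  qed
  then show ?thesis
    unfolding sdp_feasible_def Let_def loewner_le_def D_def[symmetric] mmul_assoc K_def[symmetric] psd_bform
    using sym by simp
qed

lemma bform_le_of_ball:
  assumes r: "0 < r" and le: "\<And>\<beta>. \<beta> \<in> ball_B d r \<Longrightarrow> bform d S (mv d D \<beta>) (mv d D \<beta>) \<le> b"
  shows "bform d S (mv d D x) (mv d D x) \<le> b / r\<^sup>2 * dotp d x x"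
proof (cases "dotp d x x = 0")
  case True
  then have "\<forall>i<d. x i = 0" by (simp add: dotp_self_eq_0_iff)
  then have "mv d D x = (\<lambda>i. 0)" by (simp add: mv_def)
  then show ?thesis using True by (simp add: bform_altdef)
next
  case False
  then have pos: "dotp d x x > 0" using dotp_nonneg[of d x] by simp
  define c where "c = r / sqrt (dotp d x x)"
  have c2: "c\<^sup>2 * dotp d x x = r\<^sup>2" "c\<^sup>2 > 0" using pos r by (auto simp: c_def power_divide)
  have "dotp d (\<lambda>i. c * x i) (\<lambda>i. c * x i) = r\<^sup>2"
    using c2 by (simp add: dotp_scale_left dotp_scale_right power2_eq_square mult.assoc)
  then have "bform d S (mv d D (\<lambda>i. c * x i)) (mv d D (\<lambda>i. c * x i)) \<le> b" by (intro le) (simp add: ball_B_def)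
  moreover have "mv d D (\<lambda>i. c * x i) = (\<lambda>i. c * mv d D x i)"
    by (simp add: mv_def sum_distrib_left mult_ac)
  ultimately have "c\<^sup>2 * bform d S (mv d D x) (mv d D x) \<le> b" by (simp add: bform_scale)
  also have "b = c\<^sup>2 * (b / r\<^sup>2 * dotp d x x)" using c2 r by (simp add: field_simps)
  finally show ?thesis using c2(2) by (rule mult_left_le_imp_le)
qed

lemma oracle_inequality:
  assumes d: "1 \<le> d" and n: "1 \<le> n" and \<sigma>: "0 < \<sigma>" and r: "0 < r"
    and p: "vec_dist d p" "finite_second_moments d p"
    and S: "psd d S" "definite d S"
    and eS: "0 \<le> eS" "eS \<le> 1 / 2" and eU: "0 \<le> eU" "eU \<le> 1 / 2"
    and covS: "\<And>u. \<bar>bform d (covhat n XS) u u - bform d S u u\<bar> \<le> eS * bform d S u u"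
    and covU: "\<And>u. \<bar>bform d (covhat m XU) u u - bform d (smom p) u u\<bar> \<le> eU * bform d (smom p) u u"
    and opt: "sdp_optimal d r \<sigma> n (covhat n XS) (covhat m XU) C \<tau>"
  shows "loss_B d n \<sigma> r p XS (betahat d n XS C)
    \<le> ennreal (1 + 8 * eU + 2 * eS) * loss_R d n \<sigma> r p S (\<lambda>y. mv d A y)"
proof -
  let ?SS = "covhat n XS" and ?SU = "covhat m XU" and ?T = "smom p"
  define tr where "tr = (\<lambda>C G S. mtrace d (mmul d (mmul d (mmul d C G) (transp C)) S))"
  define D where "D = (\<lambda>C i j. C i j - idm i j :: real)"
  define q where "q = (\<lambda>S C x. bform d S (mv d (D C) x) (mv d (D C) x))"
  define G where "G = pinv d S"
  define H where "H = pinv d ?SS"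
  define k where "k = \<sigma>\<^sup>2 / real n"
  have k: "k \<ge> 0" by (simp add: k_def)
  have T: "psd d ?T" by (rule psd_smom[OF p(2)])
  have symS: "msym d S" "msym d ?SS" using S(1) psd_covhat by (auto simp: psd_def)
  have SSlow: "(1 - eS) * bform d S u u \<le> bform d ?SS u u" for u
    using covS[of u] by (simp add: algebra_simps abs_le_iff)
  have SUlow: "bform d ?T u u \<le> 1 / (1 - eU) * bform d ?SU u u" for u
    using covU[of u] eU by (simp add: algebra_simps abs_le_iff pos_le_divide_eq)
  have SUup: "bform d ?SU u u \<le> (1 + eU) * bform d ?T u u" for u
    using covU[of u] by (simp add: algebra_simps abs_le_iff)
  have SSpd: "definite d ?SS"
    unfolding definite_def
  proof (intro allI impI)
    fix x a assume x: "bform d ?SS x x = 0" "a < d"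
    have "(1 - eS) * bform d S x x \<le> 0" using SSlow[of x] x by simp
    then have "bform d S x x \<le> 0" using eS by (simp add: mult_le_0_iff)
    then have "bform d S x x = 0" using S(1) by (simp add: psd_bform antisym)
    then show "x a = 0" using S(2) x unfolding definite_def by blast
  qed
  have psdG: "psd d G" unfolding G_def by (rule psd_pinv[OF S(1)])
  have psdH: "psd d H" unfolding H_def by (rule psd_pinv[OF psd_covhat])
  have HG: "bform d H x x \<le> 1 / (1 - eS) * bform d G x x" for x
  proof -
    have "bform d H x x \<le> bform d G x x / (1 - eS)"
    proof (rule bform_inverse_antimono[OF S(1) _ SSlow])
      show "mv d S (mv d G x) a = x a" if "a < d" for x a
        unfolding G_def by (intro mv_mv_pinv_definite symS S(2) that)
      show "mv d ?SS (mv d H x) a = x a" if "a < d" for x a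
        unfolding H_def by (intro mv_mv_pinv_definite symS SSpd that)
    qed (use eS in simp)
    then show ?thesis by simp
  qed
  have feas: "sdp_feasible d ?SU C \<tau> \<longleftrightarrow> (\<forall>x. q ?SU C x \<le> \<tau> * dotp d x x)" for C \<tau>
    unfolding q_def D_def by (rule sdp_feasible_iff[OF transp_covhat])
  have q_nonneg: "0 \<le> q ?SU C x" for C x using psd_covhat by (simp add: q_def psd_bform)
  have obj: "sdp_obj d r \<sigma> n ?SS ?SU C \<tau> = r\<^sup>2 * \<tau> + k * tr C H ?SU" for C \<tau>
    by (simp add: sdp_obj_def k_def tr_def H_def)
  have feasC: "q ?SU C x \<le> \<tau> * dotp d x x" for x using opt feas by (simp add: sdp_optimal_def)
  have \<tau>: "0 \<le> \<tau>"
  proof -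
    define e :: "nat \<Rightarrow> real" where "e = (\<lambda>i. if i = 0 then 1 else 0)"
    have "dotp d e e = 1"
      using d unfolding dotp_def e_def by (simp add: if_distrib[of "\<lambda>x. x * _"] sum.delta cong: if_cong)
    then show ?thesis using feasC[of e] q_nonneg[of C e] by simp
  qed
  have lossB: "loss_B d n \<sigma> r p XS (betahat d n XS C) = (SUP \<beta>\<in>ball_B d r. ennreal (q ?T C \<beta> + k * tr C H ?T))"
    unfolding loss_B_betahat[OF p \<sigma> n SSpd] q_def D_def k_def tr_def H_def ..
  have upper: "loss_B d n \<sigma> r p XS (betahat d n XS C) \<le> ennreal (1 / (1 - eU) * (r\<^sup>2 * \<tau> + k * tr C H ?SU))"
    unfolding lossB
  proof (rule SUP_least, rule ennreal_leI)
    fix \<beta> assume "\<beta> \<in> ball_B d r"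
    then have \<beta>: "dotp d \<beta> \<beta> \<le> r\<^sup>2" by (simp add: ball_B_def)
    have "q ?T C \<beta> \<le> 1 / (1 - eU) * q ?SU C \<beta>" unfolding q_def by (rule SUlow)
    also have "\<dots> \<le> 1 / (1 - eU) * (r\<^sup>2 * \<tau>)"
      using feasC[of \<beta>] mult_left_mono[OF \<beta> \<tau>] eU by (intro mult_left_mono) (auto simp: mult.commute)
    finally have "q ?T C \<beta> \<le> 1 / (1 - eU) * (r\<^sup>2 * \<tau>)" .
    moreover have "tr C H ?T \<le> 1 / (1 - eU) * tr C H ?SU"
      unfolding tr_def by (rule trace_mono_outer[OF psdH SUlow])
    then have "k * tr C H ?T \<le> 1 / (1 - eU) * (k * tr C H ?SU)"
      using mult_left_mono[OF _ k] by fastforce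
    ultimately show "q ?T C \<beta> + k * tr C H ?T \<le> 1 / (1 - eU) * (r\<^sup>2 * \<tau> + k * tr C H ?SU)"
      unfolding distrib_left by linarith
  qed
  define C' where "C' = mmul d A (msqrt d S)"
  define V where "V = k * tr C' G ?T"
  have V: "0 \<le> V" unfolding V_def tr_def by (intro mult_nonneg_nonneg k trace_nonneg T psdG)
  have lossR: "loss_R d n \<sigma> r p S (\<lambda>y. mv d A y) = (SUP \<beta>\<in>ball_B d r. ennreal (q ?T C' \<beta> + V))"
    unfolding loss_R_linear[OF p \<sigma> n S] V_def q_def D_def k_def tr_def C'_def G_def ..
  show ?thesis
  proof (cases "loss_R d n \<sigma> r p S (\<lambda>y. mv d A y) = \<infinity>")
    case True
    then show ?thesis using eS eU by (simp add: ennreal_mult_top)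
  next
    case False
    then obtain l where l: "0 \<le> l" "loss_R d n \<sigma> r p S (\<lambda>y. mv d A y) = ennreal l"
      by (cases "loss_R d n \<sigma> r p S (\<lambda>y. mv d A y)") auto
    have qV: "q ?T C' \<beta> + V \<le> l" if "\<beta> \<in> ball_B d r" for \<beta>
    proof -
      have "ennreal (q ?T C' \<beta> + V) \<le> ennreal l"
        unfolding l(2)[symmetric] lossR by (rule SUP_upper[OF that])
      then show ?thesis using l(1) by (simp add: ennreal_le_iff)
    qed
    have "(\<lambda>i. 0) \<in> ball_B d r" by (simp add: ball_B_def dotp_def)
    from qV[OF this] have lV: "V \<le> l" using T by (simp add: q_def psd_bform) (smt (verit))
    define \<tau>' where "\<tau>' = (1 + eU) * ((l - V) / r\<^sup>2)"
    have "q ?SU C' x \<le> \<tau>' * dotp d x x" for x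
    proof -
      have "q ?SU C' x \<le> (1 + eU) * q ?T C' x" unfolding q_def by (rule SUup)
      also have "q ?T C' x \<le> (l - V) / r\<^sup>2 * dotp d x x"
        unfolding q_def using qV by (intro bform_le_of_ball[OF r]) (auto simp: q_def algebra_simps)
      finally show ?thesis using eU by (simp add: \<tau>'_def mult.assoc mult_left_mono)
    qed
    then have "sdp_feasible d ?SU C' \<tau>'" by (simp add: feas)
    then have "r\<^sup>2 * \<tau> + k * tr C H ?SU \<le> r\<^sup>2 * \<tau>' + k * tr C' H ?SU"
      using opt by (simp add: sdp_optimal_def obj)
    also have "r\<^sup>2 * \<tau>' = (1 + eU) * (l - V)" using r by (simp add: \<tau>'_def)
    also have "k * tr C' H ?SU \<le> (1 + eU) * (1 / (1 - eS) * V)"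
    proof -
      have "tr C' H ?SU \<le> (1 + eU) * tr C' H ?T"
        unfolding tr_def by (rule trace_mono_outer[OF psdH SUup])
      also have "\<dots> \<le> (1 + eU) * (1 / (1 - eS) * tr C' G ?T)"
        unfolding tr_def using eU by (intro mult_left_mono trace_mono_inner[OF T HG]) auto
      finally have "k * tr C' H ?SU \<le> k * ((1 + eU) * (1 / (1 - eS) * tr C' G ?T))"
        by (rule mult_left_mono[OF _ k])
      then show ?thesis by (simp add: V_def mult_ac)
    qed
    also have "(1 + eU) * (l - V) + (1 + eU) * (1 / (1 - eS) * V) \<le> (1 + eU) * (1 / (1 - eS) * l)"
    proof -
      have "1 * (l - V) \<le> 1 / (1 - eS) * (l - V)" using lV eS by (intro mult_right_mono) auto
      then have "(l - V) + 1 / (1 - eS) * V \<le> 1 / (1 - eS) * l" by (simp add: algebra_simps diff_divide_distrib)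
      then show ?thesis unfolding distrib_left[symmetric] using eU by (intro mult_left_mono) auto
    qed
    finally have "1 / (1 - eU) * (r\<^sup>2 * \<tau> + k * tr C H ?SU) \<le> 1 / (1 - eU) * ((1 + eU) * (1 / (1 - eS) * l))"
      using eU by (intro mult_left_mono) auto
    also have "\<dots> = (1 / (1 - eU)) * (1 + eU) * (1 / (1 - eS)) * l" by simp
    also have "\<dots> \<le> (1 + 8 * eU + 2 * eS) * l"
    proof (rule mult_right_mono[OF _ l(1)])
      have inv: "1 / (1 - e) \<le> 1 + 2 * e" if "0 \<le> e" "e \<le> 1 / 2" for e :: real
      proof -
        have "0 \<le> e * (1 - 2 * e)" using that by (intro mult_nonneg_nonneg) auto
        then show ?thesis using that by (simp add: pos_divide_le_eq algebra_simps)
      qed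
      have "(1 / (1 - eU)) * (1 + eU) * (1 / (1 - eS)) \<le> (1 + 2 * eU) * (1 + eU) * (1 + 2 * eS)"
        using eU eS by (intro mult_mono inv) auto
      also have "(1 + 2 * eU) * (1 + eU) = 1 + 3 * eU + 2 * (eU * eU)" by (simp add: algebra_simps)
      also have "\<dots> \<le> 1 + 4 * eU" using mult_left_mono[OF eU(2,1)] by simp
      also have "(1 + 4 * eU) * (1 + 2 * eS) = 1 + 4 * eU + 2 * eS + 8 * (eU * eS)" by (simp add: algebra_simps)
      also have "\<dots> \<le> 1 + 8 * eU + 2 * eS" using mult_left_mono[OF eS(2) eU(1)] by (simp add: mult_ac)
      finally show "(1 / (1 - eU)) * (1 + eU) * (1 / (1 - eS)) \<le> 1 + 8 * eU + 2 * eS"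
        using eS by (simp add: mult_right_mono)
    qed
    finally have "1 / (1 - eU) * (r\<^sup>2 * \<tau> + k * tr C H ?SU) \<le> (1 + 8 * eU + 2 * eS) * l" .
    then have "loss_B d n \<sigma> r p XS (betahat d n XS C) \<le> ennreal ((1 + 8 * eU + 2 * eS) * l)"
      using upper by (meson ennreal_leI order_trans)
    then show ?thesis unfolding l(2) using eS eU l(1) by (simp add: ennreal_mult)
  qed
qed

theorem theorem7:
  shows "\<exists>c0 C1 C2 :: real. C1 > 0 \<and> C2 > 0 \<and>
    (\<forall>(d::nat) (nS::nat) (nU::nat) (\<sigma>::real) (r::real) (\<rho>::real) (\<delta>::real)
       (pS :: (nat \<Rightarrow> real) measure) (pT :: (nat \<Rightarrow> real) measure).
      1 \<le> d \<and> 1 \<le> nS \<and> 1 \<le> nU \<and> 0 < \<sigma> \<and> 0 < r \<and> 0 < \<rho> \<and> 0 < \<delta> \<and> \<delta> < 1 \<and>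
      vec_dist d pS \<and> vec_dist d pT \<and>
      mean_zero d pS \<and> mean_zero d pT \<and>
      finite_second_moments d pS \<and> finite_second_moments d pT \<and>
      minvertible d (smom pS) \<and>
      subgaussian d \<rho> pS \<and> subgaussian d \<rho> pT \<and>
      real nS \<ge> c0 * \<rho>^4 * (real d + ln (1 / \<delta>)) \<and>
      real nU \<ge> c0 * \<rho>^4 * (real d + ln (1 / \<delta>))
      \<longrightarrow>
      (let M = PiM {..<nS} (\<lambda>_. pS) \<Otimes>\<^sub>M PiM {..<nU} (\<lambda>_. pT) in
       \<exists>E \<in> sets M. measure M E \<ge> 1 - \<delta> \<and>
         (\<forall>(XS, XU) \<in> E. \<forall>C \<tau>.
            sdp_optimal d r \<sigma> nS (covhat nS XS) (covhat nU XU) C \<tau> \<longrightarrow>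
            loss_B d nS \<sigma> r pT XS (betahat d nS XS C)
              \<le> ennreal (1 + C1 * sqrt (\<rho>^4 * (real d + ln (1 / \<delta>)) / real nU)
                           + C2 * sqrt (\<rho>^4 * (real d + ln (1 / \<delta>)) / real nS))
                * (INF A. loss_R d nS \<sigma> r pT (smom pS) (\<lambda>y. mv d A y)))))"
proof (rule exI[of _ "1536\<^sup>2"], rule exI[of _ 6144], rule exI[of _ 1536], intro conjI allI impI, goal_cases)
  case (3 d nS nU \<sigma> r \<rho> \<delta> pS pT)
  then have d: "1 \<le> d" and nS: "1 \<le> nS" and nU: "1 \<le> nU" and \<sigma>: "0 < \<sigma>" and r: "0 < r" and \<rho>: "0 < \<rho>"
    and \<delta>: "0 < \<delta>" "\<delta> < 1" and pS: "vec_dist d pS" "finite_second_moments d pS" "mean_zero d pS" "subgaussian d \<rho> pS"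
    and pT: "vec_dist d pT" "finite_second_moments d pT" "mean_zero d pT" "subgaussian d \<rho> pT"
    and inv: "minvertible d (smom pS)"
    and largeS: "1536\<^sup>2 * \<rho>^4 * (real d + ln (1 / \<delta>)) \<le> real nS"
    and largeU: "1536\<^sup>2 * \<rho>^4 * (real d + ln (1 / \<delta>)) \<le> real nU"
    by auto
  define b where "b = real d + ln (1 / \<delta>)"
  have b: "0 < b" using d \<delta> by (auto simp: b_def intro: add_pos_nonneg)
  have "2 / 5 \<le> \<rho>\<^sup>2" by (rule subgaussian_parameter_lower_bound[OF pS d inv])
  then have "(2 / 5)\<^sup>2 \<le> (\<rho>\<^sup>2)\<^sup>2" by (intro power_mono) auto
  then have \<rho>4: "16 \<le> 1536\<^sup>2 * \<rho> ^ 4" by (simp add: power2_eq_square power4_eq_xxxx)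
  define e where "e = (\<lambda>n. 768 * sqrt (\<rho> ^ 4 * b / real n))"
  have size: "16 * b \<le> real n \<and> 0 \<le> e n \<and> e n \<le> 1 / 2" if "1 \<le> n" "1536\<^sup>2 * \<rho>^4 * b \<le> real n" for n
  proof (intro conjI)
    have "16 * b \<le> 1536\<^sup>2 * \<rho> ^ 4 * b" using b by (intro mult_right_mono \<rho>4) simp
    then show "16 * b \<le> real n" using that(2) by (rule order_trans)
    show "0 \<le> e n" using b by (simp add: e_def)
    have "\<rho> ^ 4 * b / real n \<le> (1 / 1536)\<^sup>2"
      using that by (simp add: power_divide field_simps)
    then have "sqrt (\<rho> ^ 4 * b / real n) \<le> 1 / 1536" by (rule real_le_lsqrt[rotated]) simp
    then show "e n \<le> 1 / 2" by (simp add: e_def)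
  qed
  let ?PS = "PiM {..<nS} (\<lambda>_. pS)" and ?PU = "PiM {..<nU} (\<lambda>_. pT)"
  interpret PS: prob_space ?PS using pS(1) by (intro prob_space_PiM vec_dist_prob_space)
  interpret PU: prob_space ?PU using pT(1) by (intro prob_space_PiM vec_dist_prob_space)
  obtain ES where ES: "ES \<in> sets ?PS" "1 - \<delta> / 2 \<le> measure ?PS ES"
    "\<And>X u. X \<in> ES \<Longrightarrow> \<bar>bform d (covhat nS X) u u - bform d (smom pS) u u\<bar> \<le> e nS * bform d (smom pS) u u"
    using empirical_smom_concentration[OF pS d nS \<rho> \<delta>] size[OF nS] largeS unfolding b_def e_def by blast
  obtain EU where EU: "EU \<in> sets ?PU" "1 - \<delta> / 2 \<le> measure ?PU EU"
    "\<And>X u. X \<in> EU \<Longrightarrow> \<bar>bform d (covhat nU X) u u - bform d (smom pT) u u\<bar> \<le> e nU * bform d (smom pT) u u"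
    using empirical_smom_concentration[OF pT d nU \<rho> \<delta>] size[OF nU] largeU unfolding b_def e_def by blast
  let ?M = "?PS \<Otimes>\<^sub>M ?PU"
  have meas: "1 - \<delta> \<le> measure ?M (ES \<times> EU)"
  proof -
    have "1 - \<delta> \<le> (1 - \<delta> / 2) * (1 - \<delta> / 2)" by (simp add: algebra_simps)
    also have "\<dots> \<le> measure ?PS ES * measure ?PU EU" using \<delta> ES(2) EU(2) by (intro mult_mono) auto
    also have "\<dots> = measure ?M (ES \<times> EU)"
      using PU.emeasure_pair_measure_Times[OF ES(1) EU(1)] by (simp add: measure_def enn2real_mult)
    finally show ?thesis .
  qed
  have "loss_B d nS \<sigma> r pT XS (betahat d nS XS C)
      \<le> ennreal (1 + 6144 * sqrt (\<rho>^4 * b / real nU) + 1536 * sqrt (\<rho>^4 * b / real nS))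
        * (INF A. loss_R d nS \<sigma> r pT (smom pS) (\<lambda>y. mv d A y))"
    if XS: "XS \<in> ES" and XU: "XU \<in> EU"
      and opt: "sdp_optimal d r \<sigma> nS (covhat nS XS) (covhat nU XU) C \<tau>" for XS XU C \<tau>
  proof -
    let ?l = "loss_B d nS \<sigma> r pT XS (betahat d nS XS C)"
    define K where "K = 1 + 8 * e nU + 2 * e nS"
    have K: "0 < K" using size[OF nS] size[OF nU] largeS largeU by (simp add: K_def b_def add_pos_nonneg)
    have psdS: "psd d (smom pS)" by (rule psd_smom[OF pS(2)])
    have "?l \<le> ennreal K * loss_R d nS \<sigma> r pT (smom pS) (\<lambda>y. mv d A y)" for A
      unfolding K_def
      using size[OF nS] size[OF nU] largeS largeU unfolding b_def[symmetric]
      by (intro oracle_inequality[OF d nS \<sigma> r pT(1,2) psdS minvertible_psd_definite[OF psdS inv]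
            _ _ _ _ ES(3)[OF XS] EU(3)[OF XU] opt]) auto
    then have "?l / ennreal K \<le> (INF A. loss_R d nS \<sigma> r pT (smom pS) (\<lambda>y. mv d A y))"
      using K by (intro INF_greatest divide_le_posI_ennreal) auto
    then have "ennreal K * (?l / ennreal K) \<le> ennreal K * (INF A. loss_R d nS \<sigma> r pT (smom pS) (\<lambda>y. mv d A y))"
      by (rule mult_left_mono) simp
    moreover have "ennreal K * (?l / ennreal K) = ?l"
      unfolding ennreal_times_divide mult.commute[of "ennreal K"] using K by (intro mult_divide_eq_ennreal) auto
    moreover have "K = 1 + 6144 * sqrt (\<rho>^4 * b / real nU) + 1536 * sqrt (\<rho>^4 * b / real nS)"
      by (simp add: K_def e_def)
    ultimately show ?thesis by simp
  qed
  then show ?case unfolding Let_def b_def[symmetric] using meas ES(1) EU(1)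
    by (intro bexI[of _ "ES \<times> EU"]) auto
qed auto

end
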